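(* For $\mathbf{c},\mathbf{d}\in\ell^2(\mathbb{R})$ let $(W(\mathbf{c},\mathbf{d}))(t):=\mathbf{c}^T\mathbf{w}(t)\mathbf{w}^T(t)\mathbf{d}=\big(\sum_i c_iw_i(t)\big)\big(\sum_i d_iw_i(t)\big)$, $t\in[0,1]$, with the notation of the context. Then $W$ is bounded as a bilinear form with values in $L^2([0,1])$: there exists $C>0$ such that $$\|W(\mathbf{c},\mathbf{d})\|_{L^2}\le C\,\|\mathbf{c}\|_{\ell^2}\|\mathbf{d}\|_{\ell^2}\quad\text{for all }\mathbf{c},\mathbf{d}\in\ell^2(\mathbb{R}).$$ Additionally, for all $\mathbf{c},\mathbf{d}\in\ell^2(\mathbb{R})$, setting $\mathbf{a}:=P^T\mathbf{c}$ and $\mathbf{b}:=P^T\mathbf{d}$, one has (as functions in $L^2([0,1])$) $$\mathbf{c}^T\mathbf{w}(t)\mathbf{w}^T(t)\mathbf{d}=\mathbf{a}^T\Omega(t)\mathbf{b}+\mathbf{a}^T\Omega^T(t)\mathbf{b}+\mathbf{a}^T\Theta(t)\mathbf{b},$$ where $\Omega(t)$ is the infinite matrix whose leading $2^j\times 2^j$ blocks are recursively defined by $$\Omega_1(t)=0,\qquad \Omega_{2m}(t)=\begin{bmatrix}\Omega_m(t)&\Upsilon_m(t)\\0_{m\times m}&0_{m\times m}\end{bmatrix},\qquad(\Upsilon_m)_{i,l}(t)=(H_m)_{i,l}\,\psi_{m+l}(t)\quad(1\le i,l\le m),$$ for $m=2^j$, $j=0,1,2,\dots$, and $\Theta(t)$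 is the infinite diagonal matrix with diagonal entries $\psi_1^2(t),\psi_2^2(t),\psi_3^2(t),\dots$. Moreover, $$\mathcal{H}(\mathbf{c}^T\mathbf{w}(t)\mathbf{w}^T(t)\mathbf{d})=\mathcal{H}(\mathbf{a}^T\Omega(t)\mathbf{b})+\mathcal{H}(\mathbf{a}^T\Omega^T(t)\mathbf{b})+\mathcal{H}(\mathbf{a}^T\Theta(t)\mathbf{b})$$ and $$\mathcal{H}(\mathbf{a}^T\Omega(t)\mathbf{b})=(\tilde\Omega^T\mathbf{a})\odot\mathbf{b},\qquad \mathcal{H}(\mathbf{a}^T\Omega^T(t)\mathbf{b})=(\tilde\Omega^T\mathbf{b})\odot\mathbf{a},\qquad \mathcal{H}(\mathbf{a}^T\Theta(t)\mathbf{b})=\Gamma^T(\mathbf{a}\odot\mathbf{b}),$$ where $\tilde\Omega$ and $\Gamma$ are the infinite matrices whose leading $2^j\times2^j$ blocks are recursively defined, for $m=2^j$, $j=0,1,2,\dots$, by $$\tilde\Omega_1=0,\quad\tilde\Omega_{2m}=\begin{bmatrix}\tilde\Omega_m&H_m\\0_{m\times m}&0_{m\times m}\end{bmatrix},\qquad \Gamma_1=1,\quad\Gamma_{2m}=\begin{bmatrix}\Gamma_m&0_{m\times m}\\H_m^T&0_{m\times m}\end{bmatrix}.$$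
   Context: Haar wavelets on $[0,1]$: $\psi_1=\phi$ is $1$ on $[0,1)$ and $0$ otherwise; for $i=2^j+k+1$ with $j\ge0$, $0\le k\le 2^j-1$, $\psi_i=\psi_{j,k}$ equals $2^{j/2}$ on $[\frac{k}{2^j},\frac{k+0.5}{2^j})$, $-2^{j/2}$ on $[\frac{k+0.5}{2^j},\frac{k+1}{2^j})$ and $0$ otherwise. They form an orthonormal basis of $L^2([0,1])$. The Haar transform $\mathcal{H}:L^2([0,1])\to\ell^2(\mathbb{R})$ is $(\mathcal{H}f)_i=\int_0^1f(t)\psi_i(t)\,dt$. $w_i(t)=\int_0^t\psi_i(s)\,ds$ for $t\in[0,1]$, and $\mathbf{w}(t)=(w_1(t),w_2(t),\dots)^T$. $P$ is the infinite matrix $P_{i,l}=\int_0^1\psi_l(t)w_i(t)\,dt$; $P^T$ acts as a bounded linear operator on $\ell^2(\mathbb{R})$. For $m=2^j$, $j\ge0$, the Haar matrix $H_m$ is the $m\times m$ matrix $(H_m)_{p,q}=\psi_p\big(\frac{q-0.5}{m}\big)$, $1\le p,q\le m$. For sequences $\mathbf{a},\mathbf{b}$ and an infinite matrix $N(t)$, $\mathbf{a}^TN(t)\mathbf{b}=\sum_{i,l}a_iN_{i,l}(t)b_l$. $\odot$ is the element-wise (Hadamard) product of sequences. $\|\cdot\|_{L^2}$ is the norm of $L^2([0,1])$. *)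

theory Defs
  imports
    "HOL-Analysis.Analysis"
    "HOL-Library.Discrete_Functions"
    "Jordan_Normal_Form.Matrix"
begin

text \<open>
  Sequences and infinite matrices are indexed by \<open>{1..}\<close>; values at index 0 are ignored
  everywhere. All infinite sums are unordered (for real terms: absolutely convergent) sums.
  Finite matrices are those of \<open>Jordan_Normal_Form\<close>, whose indices start at 0.
\<close>

section \<open>The spaces \<open>\<ell>\<^sup>2\<close> and \<open>L\<^sup>2([0,1])\<close>\<close>

definition ell2 :: "(nat \<Rightarrow> real) set" where
  "ell2 = {c. (\<lambda>i. (c i)\<^sup>2) summable_on {1..}}"

definition ell2_norm :: "(nat \<Rightarrow> real) \<Rightarrow> real" where
  "ell2_norm c = sqrt (\<Sum>\<^sub>\<infinity>i\<in>{1..}. (c i)\<^sup>2)"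

text \<open>Elements of \<open>L\<^sup>2([0,1])\<close> are represented by functions; they are equal if they agree a.e.\<close>

definition L2_01 :: "(real \<Rightarrow> real) set" where
  "L2_01 = {f. f \<in> borel_measurable (lebesgue_on {0..1}) \<and>
               integrable (lebesgue_on {0..1}) (\<lambda>t. (f t)\<^sup>2)}"

definition L2_01_norm :: "(real \<Rightarrow> real) \<Rightarrow> real" where
  "L2_01_norm f = sqrt (LINT t|lebesgue_on {0..1}. (f t)\<^sup>2)"

definition bilinear_ell2_L2 :: "((nat \<Rightarrow> real) \<Rightarrow> (nat \<Rightarrow> real) \<Rightarrow> real \<Rightarrow> real) \<Rightarrow> bool" where
  "bilinear_ell2_L2 B \<longleftrightarrow>
     (\<forall>c\<in>ell2. \<forall>d\<in>ell2. B c d \<in> L2_01) \<and>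
     (\<forall>c\<in>ell2. \<forall>c'\<in>ell2. \<forall>d\<in>ell2. \<forall>r s. AE t in lebesgue_on {0..1}.
        B (\<lambda>i. r * c i + s * c' i) d t = r * B c d t + s * B c' d t) \<and>
     (\<forall>c\<in>ell2. \<forall>d\<in>ell2. \<forall>d'\<in>ell2. \<forall>r s. AE t in lebesgue_on {0..1}.
        B c (\<lambda>i. r * d i + s * d' i) t = r * B c d t + s * B c d' t)"

section \<open>Infinite matrices\<close>

definition transp_inf :: "(nat \<Rightarrow> nat \<Rightarrow> real) \<Rightarrow> nat \<Rightarrow> nat \<Rightarrow> real" where
  "transp_inf N i l = N l i"

definition app_inf :: "(nat \<Rightarrow> nat \<Rightarrow> real) \<Rightarrow> (nat \<Rightarrow> real) \<Rightarrow> nat \<Rightarrow> real" where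
  "app_inf N x i = (\<Sum>\<^sub>\<infinity>l\<in>{1..}. N i l * x l)"

definition app_inf_converges :: "(nat \<Rightarrow> nat \<Rightarrow> real) \<Rightarrow> (nat \<Rightarrow> real) \<Rightarrow> bool" where
  "app_inf_converges N x \<longleftrightarrow> (\<forall>i\<ge>1. (\<lambda>l. N i l * x l) summable_on {1..})"

text \<open>\<open>bil a N b\<close> is \<open>a\<^sup>T N b\<close>. An \<open>infsum\<close> that does not converge is 0 by convention, hence
  the separate convergence predicate.\<close>

definition bil :: "(nat \<Rightarrow> real) \<Rightarrow> (nat \<Rightarrow> nat \<Rightarrow> real) \<Rightarrow> (nat \<Rightarrow> real) \<Rightarrow> real" where
  "bil a N b = (\<Sum>\<^sub>\<infinity>(i, l)\<in>{1..} \<times> {1..}. a i * N i l * b l)"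

definition bil_converges :: "(nat \<Rightarrow> real) \<Rightarrow> (nat \<Rightarrow> nat \<Rightarrow> real) \<Rightarrow> (nat \<Rightarrow> real) \<Rightarrow> bool" where
  "bil_converges a N b \<longleftrightarrow> (\<lambda>(i, l). a i * N i l * b l) summable_on ({1..} \<times> {1..})"

definition hadamard :: "(nat \<Rightarrow> real) \<Rightarrow> (nat \<Rightarrow> real) \<Rightarrow> nat \<Rightarrow> real" where
  "hadamard x y i = x i * y i"

definition leading_block :: "nat \<Rightarrow> (nat \<Rightarrow> nat \<Rightarrow> real) \<Rightarrow> real mat" where
  "leading_block n N = mat n n (\<lambda>(p, q). N (p + 1) (q + 1))"

text \<open>The infinite matrix with given leading \<open>2^j \<times> 2^j\<close> blocks \<open>B j\<close>: an entry is read off the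
  smallest block that contains it.\<close>

definition inf_of_blocks :: "(nat \<Rightarrow> real mat) \<Rightarrow> nat \<Rightarrow> nat \<Rightarrow> real" where
  "inf_of_blocks B i l = B (LEAST j. i \<le> 2 ^ j \<and> l \<le> 2 ^ j) $$ (i - 1, l - 1)"

lemma leading_block_inf_of_blocks:
  assumes dim: "\<And>j. B j \<in> carrier_mat (2 ^ j) (2 ^ j)"
    and step: "\<And>j p q. p < 2 ^ j \<Longrightarrow> q < 2 ^ j \<Longrightarrow> B (Suc j) $$ (p, q) = B j $$ (p, q)"
  shows "leading_block (2 ^ j) (inf_of_blocks B) = B j"
proof (rule eq_matI)
  show "dim_row (leading_block (2 ^ j) (inf_of_blocks B)) = dim_row (B j)"
    and "dim_col (leading_block (2 ^ j) (inf_of_blocks B)) = dim_col (B j)"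
    using dim[of j] by (auto simp: leading_block_def)
next
  fix p q assume "p < dim_row (B j)" "q < dim_col (B j)"
  then have pq: "p < 2 ^ j" "q < 2 ^ j" using dim[of j] by auto
  define k where "k = (LEAST j. p + 1 \<le> 2 ^ j \<and> q + 1 \<le> (2::nat) ^ j)"
  have ex: "p + 1 \<le> 2 ^ j \<and> q + 1 \<le> (2::nat) ^ j" using pq by auto
  have k: "p + 1 \<le> 2 ^ k \<and> q + 1 \<le> (2::nat) ^ k"
    unfolding k_def by (rule LeastI[of _ j]) (rule ex)
  have "k \<le> j" unfolding k_def by (rule Least_le) (rule ex)
  have "B n $$ (p, q) = B k $$ (p, q)" if "k \<le> n" for n
    using that
  proof (induction n rule: dec_induct)
    case (step n)
    have "(2::nat) ^ k \<le> 2 ^ n" using step by simp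
    then have "p < 2 ^ n" "q < 2 ^ n" using k by linarith+
    then show ?case using assms(2)[of p n q] step by simp
  qed simp
  from this[OF \<open>k \<le> j\<close>]
  show "leading_block (2 ^ j) (inf_of_blocks B) $$ (p, q) = B j $$ (p, q)"
    using pq by (simp add: leading_block_def inf_of_blocks_def k_def)
qed

section \<open>Haar wavelets\<close>

definition haar_wavelet :: "nat \<Rightarrow> nat \<Rightarrow> real \<Rightarrow> real" where
  "haar_wavelet j k t =
     (if real k / 2 ^ j \<le> t \<and> t < (real k + 1/2) / 2 ^ j then 2 powr (real j / 2)
      else if (real k + 1/2) / 2 ^ j \<le> t \<and> t < (real k + 1) / 2 ^ j then - (2 powr (real j / 2))
      else 0)"

definition haar :: "nat \<Rightarrow> real \<Rightarrow> real" where
  "haar i t =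
     (if i = 1 then (if 0 \<le> t \<and> t < 1 then 1 else 0)
      else haar_wavelet (floor_log (i - 1)) (i - 1 - 2 ^ floor_log (i - 1)) t)"

lemma haar_index:
  assumes "k < 2 ^ j"
  shows "haar (2 ^ j + k + 1) = haar_wavelet j k"
proof -
  have "floor_log (2 ^ j + k) = j"
    by (rule floor_log_eqI) (use assms in auto)
  then show ?thesis by (auto simp: haar_def fun_eq_iff)
qed

definition haar_transform :: "(real \<Rightarrow> real) \<Rightarrow> nat \<Rightarrow> real" where
  "haar_transform f i = (LINT t|lebesgue_on {0..1}. f t * haar i t)"

definition haar_w :: "nat \<Rightarrow> real \<Rightarrow> real" where
  "haar_w i t = (LINT s|lebesgue_on {0..t}. haar i s)"

definition haar_P :: "nat \<Rightarrow> nat \<Rightarrow> real" where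
  "haar_P i l = (LINT t|lebesgue_on {0..1}. haar l t * haar_w i t)"

definition haar_W :: "(nat \<Rightarrow> real) \<Rightarrow> (nat \<Rightarrow> real) \<Rightarrow> real \<Rightarrow> real" where
  "haar_W c d t = bil c (\<lambda>i l. haar_w i t * haar_w l t) d"

section \<open>Haar matrices and the block recursions\<close>

text \<open>The 0-based entry \<open>(p, q)\<close> of \<open>H_m\<close> is \<open>\<psi>\<^bsub>p+1\<^esub>(((q + 1) - 1/2) / m)\<close>.\<close>

definition haar_mat :: "nat \<Rightarrow> real mat" where
  "haar_mat m = mat m m (\<lambda>(p, q). haar (p + 1) ((real q + 1/2) / real m))"

definition Upsilon :: "nat \<Rightarrow> real \<Rightarrow> real mat" where
  "Upsilon m t = mat m m (\<lambda>(p, q). haar_mat m $$ (p, q) * haar (m + (q + 1)) t)"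

primrec Omega_block :: "real \<Rightarrow> nat \<Rightarrow> real mat" where
  "Omega_block t 0 = 0\<^sub>m 1 1"
| "Omega_block t (Suc j) =
     four_block_mat (Omega_block t j)       (Upsilon (2 ^ j) t)
                    (0\<^sub>m (2 ^ j) (2 ^ j))    (0\<^sub>m (2 ^ j) (2 ^ j))"

primrec Omega_tilde_block :: "nat \<Rightarrow> real mat" where
  "Omega_tilde_block 0 = 0\<^sub>m 1 1"
| "Omega_tilde_block (Suc j) =
     four_block_mat (Omega_tilde_block j)   (haar_mat (2 ^ j))
                    (0\<^sub>m (2 ^ j) (2 ^ j))    (0\<^sub>m (2 ^ j) (2 ^ j))"

primrec Gamma_block :: "nat \<Rightarrow> real mat" where
  "Gamma_block 0 = 1\<^sub>m 1"
| "Gamma_block (Suc j) =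
     four_block_mat (Gamma_block j)                     (0\<^sub>m (2 ^ j) (2 ^ j))
                    (transpose_mat (haar_mat (2 ^ j)))  (0\<^sub>m (2 ^ j) (2 ^ j))"

definition Omega :: "real \<Rightarrow> nat \<Rightarrow> nat \<Rightarrow> real" where
  "Omega t = inf_of_blocks (Omega_block t)"

definition Omega_tilde :: "nat \<Rightarrow> nat \<Rightarrow> real" where
  "Omega_tilde = inf_of_blocks Omega_tilde_block"

definition Gamma_mat :: "nat \<Rightarrow> nat \<Rightarrow> real" where
  "Gamma_mat = inf_of_blocks Gamma_block"

definition Theta :: "real \<Rightarrow> nat \<Rightarrow> nat \<Rightarrow> real" where
  "Theta t i l = (if i = l then (haar i t)\<^sup>2 else 0)"

lemma haar_mat_carrier [simp]: "haar_mat m \<in> carrier_mat m m"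
  by (simp add: haar_mat_def)

lemma Upsilon_carrier [simp]: "Upsilon m t \<in> carrier_mat m m"
  by (simp add: Upsilon_def)

lemma Omega_block_carrier: "Omega_block t j \<in> carrier_mat (2 ^ j) (2 ^ j)"
  by (induction j) (auto simp: mult_2)

lemma Omega_tilde_block_carrier: "Omega_tilde_block j \<in> carrier_mat (2 ^ j) (2 ^ j)"
  by (induction j) (auto simp: mult_2)

lemma Gamma_block_carrier: "Gamma_block j \<in> carrier_mat (2 ^ j) (2 ^ j)"
  by (induction j) (auto simp: mult_2)

lemma leading_block_Omega: "leading_block (2 ^ j) (Omega t) = Omega_block t j"
  unfolding Omega_def
  by (rule leading_block_inf_of_blocks[OF Omega_block_carrier])
     (use Omega_block_carrier in \<open>auto simp: carrier_matD[OF Omega_block_carrier]\<close>)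

lemma leading_block_Omega_tilde: "leading_block (2 ^ j) Omega_tilde = Omega_tilde_block j"
  unfolding Omega_tilde_def
  by (rule leading_block_inf_of_blocks[OF Omega_tilde_block_carrier])
     (auto simp: carrier_matD[OF Omega_tilde_block_carrier])

lemma leading_block_Gamma: "leading_block (2 ^ j) Gamma_mat = Gamma_block j"
  unfolding Gamma_mat_def
  by (rule leading_block_inf_of_blocks[OF Gamma_block_carrier])
     (auto simp: carrier_matD[OF Gamma_block_carrier])

end

theory Submission
  imports Defs
begin

text \<open>
  For \<open>c \<in> \<ell>\<^sup>2\<close> the function \<open>f(t) = \<Sum>\<^sub>i c\<^sub>i w\<^sub>i(t)\<close> is the primitive of \<open>\<Sum>\<^sub>i c\<^sub>i \<psi>\<^sub>i\<close>. Since \<open>w\<^sub>i(t) - w\<^sub>i(s)\<close> is the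
  \<open>i\<close>-th Haar coefficient of the indicator function of \<open>(s, t]\<close>, Bessel's inequality gives
  \<open>\<bar>f(t)\<bar> \<le> \<parallel>c\<parallel>\<close> and \<open>\<bar>f(t) - f(s)\<bar> \<le> \<parallel>c\<parallel> \<bar>t - s\<bar>\<^bsup>1/2\<^esup>\<close>. In particular the bilinear form is bounded, with
  constant 1. The sequence \<open>P\<^sup>T c\<close> is the Haar transform of \<open>f\<close>; by Hoelder continuity its entries of
  level \<open>j\<close> are at most \<open>\<parallel>c\<parallel> 2\<^bsup>-j\<^esup>\<close>. At every point only one wavelet per level is nonzero, so the Haar
  expansion of \<open>f\<close> converges absolutely, with a uniform bound, and its sum is \<open>f\<close> on \<open>[0, 1)\<close>.

  The matrices encode the multiplication of wavelets: if the level of \<open>\<psi>\<^sub>i\<close> is lower than that of \<open>\<psi>\<^sub>l\<close>,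
  then \<open>\<psi>\<^sub>i\<close> is constant on the support of \<open>\<psi>\<^sub>l\<close>, and \<open>\<psi>\<^sub>i \<psi>\<^sub>l = \<Omega>\<^sub>i\<^sub>l = \<Omega>'\<^sub>i\<^sub>l \<psi>\<^sub>l\<close>, where \<open>\<Omega>'\<close> is \<open>Omega_tilde\<close>; distinct wavelets of
  the same level have disjoint supports. Hence \<open>\<psi>\<^sub>i \<psi>\<^sub>l\<close> is the \<open>(i, l)\<close> entry of \<open>\<Omega> + \<Omega>\<^sup>T + \<Theta>\<close>, which
  yields the product formula. The transforms follow from orthonormality, integrating termwise.
\<close>

section \<open>Interchanging infinite sums and integrals\<close>

text \<open>Most convergence claims take this form: a bound on finite sums of absolute values yields
  summability and, with the same constant, a bound on the value of the sum.\<close>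

lemma summable_on_if_abs_partial_sums_le:
  fixes f :: "'i \<Rightarrow> real"
  assumes "\<And>S. finite S \<Longrightarrow> S \<subseteq> A \<Longrightarrow> (\<Sum>i\<in>S. \<bar>f i\<bar>) \<le> K"
  shows "f summable_on A" and "\<bar>infsum f A\<bar> \<le> K"
proof -
  have abs: "(\<lambda>i. norm (f i)) summable_on A"
    by (rule nonneg_bdd_above_summable_on) (auto intro!: bdd_aboveI2[where M = K] assms)
  then show "f summable_on A" by (rule abs_summable_summable)
  have "\<bar>infsum f A\<bar> \<le> infsum (\<lambda>i. \<bar>f i\<bar>) A"
    using norm_infsum_bound[OF abs] by simp
  also have "\<dots> \<le> K"
    using abs by (intro infsum_le_finite_sums assms) auto
  finally show "\<bar>infsum f A\<bar> \<le> K" .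
qed

text \<open>Dominated convergence for unordered sums: on a finite measure space the constant
  \<open>K\<close> is an integrable majorant. The index set is enumerated by the naturals so that
  the theorem on series of integrals applies; absolute convergence makes the enumeration
  irrelevant.\<close>

lemma (in finite_measure) bounded_infsum_integral:
  fixes F :: "'i \<Rightarrow> 'a \<Rightarrow> real"
  assumes "countable A" "infinite A"
    and meas: "\<And>i. i \<in> A \<Longrightarrow> F i \<in> borel_measurable M"
    and bd: "\<And>t S. t \<in> space M \<Longrightarrow> finite S \<Longrightarrow> S \<subseteq> A \<Longrightarrow> (\<Sum>i\<in>S. \<bar>F i t\<bar>) \<le> K"
  shows "(\<lambda>t. \<Sum>\<^sub>\<infinity>i\<in>A. F i t) \<in> borel_measurable M"
    and "((\<lambda>i. integral\<^sup>L M (F i)) has_sum (LINT t|M. (\<Sum>\<^sub>\<infinity>i\<in>A. F i t))) A"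
proof -
  define e where "e = from_nat_into A"
  have e: "bij_betw e UNIV A" unfolding e_def by (rule bij_betw_from_nat_into) fact+
  then have inA: "e n \<in> A" for n by (auto simp: bij_betw_def)
  have inj: "inj e" using e by (auto simp: bij_betw_def)
  define G where "G n = F (e n)" for n
  have [measurable]: "G n \<in> borel_measurable M" for n
    unfolding G_def using inA by (rule meas)
  have bdG: "(\<Sum>n\<in>N. \<bar>G n t\<bar>) \<le> K" if "t \<in> space M" "finite N" for t N
  proof -
    have "(\<Sum>n\<in>N. \<bar>G n t\<bar>) = (\<Sum>i\<in>e ` N. \<bar>F i t\<bar>)"
      using inj by (subst sum.reindex) (auto simp: G_def inj_on_def)
    also have "\<dots> \<le> K" using that inA by (intro bd) auto
    finally show ?thesis .
  qed
  have infsum_G: "(\<Sum>\<^sub>\<infinity>i\<in>A. F i t) = (\<Sum>n. G n t)" if t: "t \<in> space M" for t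
  proof -
    have "(\<lambda>n. G n t) summable_on UNIV"
      using bdG[OF t] by (rule summable_on_if_abs_partial_sums_le)
    then have "(\<lambda>n. G n t) sums (\<Sum>\<^sub>\<infinity>n. G n t)"
      by (intro has_sum_imp_sums) (rule has_sum_infsum)
    moreover have "(\<Sum>\<^sub>\<infinity>n. G n t) = (\<Sum>\<^sub>\<infinity>i\<in>A. F i t)"
      unfolding G_def by (rule infsum_reindex_bij_betw[OF e])
    ultimately show ?thesis by (simp add: sums_iff)
  qed
  have "(\<lambda>t. \<Sum>n. G n t) \<in> borel_measurable M" by measurable
  then show "(\<lambda>t. \<Sum>\<^sub>\<infinity>i\<in>A. F i t) \<in> borel_measurable M"
    using infsum_G by (subst measurable_cong) auto
  have int: "integrable M (G n)" for n
    by (rule integrable_const_bound[of _ K]) (use bdG[of _ "{n}"] in auto)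
  have summ: "summable (\<lambda>n. LINT t|M. norm (G n t))"
  proof (rule summableI_nonneg_bounded)
    fix n
    have "(\<Sum>i<n. LINT t|M. norm (G i t)) = (LINT t|M. (\<Sum>i<n. norm (G i t)))"
      using int by (subst Bochner_Integration.integral_sum) auto
    also have "\<dots> \<le> (LINT t|M. K)"
      by (rule integral_mono) (use int bdG in auto)
    finally show "(\<Sum>i<n. LINT t|M. norm (G i t)) \<le> measure M (space M) * K" by simp
  qed auto
  have sumsG: "(\<lambda>n. integral\<^sup>L M (G n)) sums (LINT t|M. (\<Sum>n. G n t))"
  proof (rule sums_integral)
    show "AE t in M. summable (\<lambda>n. norm (G n t))"
      by (rule AE_I2, rule summableI_nonneg_bounded[of _ K]) (use bdG in auto)
  qed (use int summ in auto)
  have "((\<lambda>n. integral\<^sup>L M (G n)) has_sum (LINT t|M. (\<Sum>n. G n t))) UNIV"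
  proof (rule norm_summable_imp_has_sum[OF _ sumsG])
    show "summable (\<lambda>n. norm (integral\<^sup>L M (G n)))"
      by (rule summable_comparison_test[OF _ summ]) (auto intro!: exI[of _ 0])
  qed
  then have "((\<lambda>i. integral\<^sup>L M (F i)) has_sum (LINT t|M. (\<Sum>n. G n t))) A"
    unfolding G_def by (subst (asm) has_sum_reindex_bij_betw[OF e])
  also have "(LINT t|M. (\<Sum>n. G n t)) = (LINT t|M. (\<Sum>\<^sub>\<infinity>i\<in>A. F i t))"
    using infsum_G by (intro Bochner_Integration.integral_cong) auto
  finally show "((\<lambda>i. integral\<^sup>L M (F i)) has_sum (LINT t|M. (\<Sum>\<^sub>\<infinity>i\<in>A. F i t))) A" .
qed

section \<open>Dyadic intervals and products of Haar wavelets\<close>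

text \<open>Half-open, so that the intervals of one level are disjoint and membership is the single
  floor equation \<open>mem_dyad_iff\<close>. Geometry of dyadic intervals thereby becomes integer
  arithmetic.\<close>

definition dyad :: "nat \<Rightarrow> nat \<Rightarrow> real set" where
  "dyad j k = {real k / 2 ^ j ..< (real k + 1) / 2 ^ j}"

lemma mem_dyad_iff: "t \<in> dyad j k \<longleftrightarrow> \<lfloor>2 ^ j * t\<rfloor> = int k"
  by (simp add: dyad_def floor_eq_iff field_simps)

lemma haar_wavelet_dyad:
  "haar_wavelet j k t =
     2 powr (real j / 2) * (indicator (dyad (Suc j) (2 * k)) t - indicator (dyad (Suc j) (2 * k + 1)) t)"
  by (auto simp: haar_wavelet_def dyad_def indicator_def field_simps)

lemma powr_half_mult_self: "2 powr (real j / 2) * 2 powr (real j / 2) = (2::real) ^ j"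
  by (simp flip: powr_add powr_realpow)

text \<open>An instance of floor(x / n) = floor(x) div n. The index of the interval containing
  \<open>t\<close> at a fine level thus determines the index at every coarser level.\<close>

lemma floor_dyad_coarse:
  assumes "j \<le> J"
  shows "\<lfloor>2 ^ j * t\<rfloor> = \<lfloor>2 ^ J * (t::real)\<rfloor> div 2 ^ (J - j)"
proof -
  have "2 ^ j * t = 2 ^ J * t / real_of_int (2 ^ (J - j))"
    using assms by (simp add: field_simps flip: power_add)
  then show ?thesis using floor_divide_real_eq_div[of "2 ^ (J - j)" "2 ^ J * t"] by simp
qed

lemma floor_dyad_Suc: "\<lfloor>2 ^ j * t\<rfloor> = \<lfloor>2 ^ Suc j * (t::real)\<rfloor> div 2"
  using floor_dyad_coarse[of j "Suc j" t] by simp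

lemma haar_1: "haar 1 t = indicator (dyad 0 0) t"
  by (auto simp: haar_def dyad_def)

lemma haar_Suc:
  assumes "k < 2 ^ j"
  shows "haar (2 ^ j + k + 1) t =
    2 powr (real j / 2) * (indicator (dyad (Suc j) (2 * k)) t - indicator (dyad (Suc j) (2 * k + 1)) t)"
  using assms by (simp only: haar_index haar_wavelet_dyad)

section \<open>Levels of indices, supports of wavelets, and products of two wavelets\<close>

lemma haar_index_cases:
  fixes i :: nat
  assumes "1 \<le> i"
  obtains (scaling) "i = 1" | (wavelet) j k where "k < 2 ^ j" "i = 2 ^ j + k + 1"
proof (cases "i = 1")
  case False
  then have i: "i - 1 > 0" using assms by simp
  have "i = 2 ^ floor_log (i - 1) + (i - 1 - 2 ^ floor_log (i - 1)) + 1"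
    using floor_log_exp2_le[OF i] i by linarith
  moreover have "i - 1 - 2 ^ floor_log (i - 1) < 2 ^ floor_log (i - 1)"
    using floor_log_exp2_gt[of "i - 1"] floor_log_exp2_le[OF i] by linarith
  ultimately show thesis using wavelet by blast
qed (use scaling in blast)

text \<open>Translates block sizes into levels: the first \<open>2 ^ J\<close> indices are the
  scaling function and the wavelets of level below \<open>J\<close>.\<close>

lemma wavelet_index_le_iff:
  assumes "k < 2 ^ j"
  shows "2 ^ j + k + 1 \<le> (2::nat) ^ J \<longleftrightarrow> j < J"
proof
  assume "2 ^ j + k + 1 \<le> (2::nat) ^ J"
  then have "(2::nat) ^ j < 2 ^ J" by linarith
  then show "j < J" by simp
next
  assume "j < J"
  then have "(2::nat) ^ Suc j \<le> 2 ^ J" by (intro power_increasing) auto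
  then show "2 ^ j + k + 1 \<le> (2::nat) ^ J" using assms by simp
qed

lemma haar_eq_0:
  assumes "k < 2 ^ j" "t \<notin> dyad j k"
  shows "haar (2 ^ j + k + 1) t = 0"
  using assms(2) floor_dyad_Suc[of j t] unfolding haar_Suc[OF assms(1)]
  by (auto simp: mem_dyad_iff indicator_def)

lemma abs_haar:
  assumes "k < 2 ^ j"
  shows "\<bar>haar (2 ^ j + k + 1) t\<bar> = 2 powr (real j / 2) * indicator (dyad j k) t"
proof -
  have "\<lfloor>2 ^ Suc j * t\<rfloor> = 2 * int k \<or> \<lfloor>2 ^ Suc j * t\<rfloor> = 2 * int k + 1" if "\<lfloor>2 ^ j * t\<rfloor> = int k"
    using that floor_dyad_Suc[of j t] by presburger
  moreover have "\<lfloor>2 ^ j * t\<rfloor> = int k" if "\<lfloor>2 ^ Suc j * t\<rfloor> = 2 * int k \<or> \<lfloor>2 ^ Suc j * t\<rfloor> = 2 * int k + 1"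
    using that floor_dyad_Suc[of j t] by presburger
  ultimately show ?thesis
    unfolding haar_Suc[OF assms] by (auto simp: mem_dyad_iff indicator_def)
qed

lemma haar_power2:
  assumes "k < 2 ^ j"
  shows "(haar (2 ^ j + k + 1) t)\<^sup>2 = 2 ^ j * indicator (dyad j k) t"
proof -
  have "(haar (2 ^ j + k + 1) t)\<^sup>2 = \<bar>haar (2 ^ j + k + 1) t\<bar> * \<bar>haar (2 ^ j + k + 1) t\<bar>"
    by (simp add: power2_eq_square)
  also have "\<dots> = 2 ^ j * indicator (dyad j k) t"
    unfolding abs_haar[OF assms] using powr_half_mult_self[of j] by (simp add: indicator_def)
  finally show ?thesis .
qed

text \<open>The level of such a wavelet is below \<open>J\<close>, so its positive and negative
  halves have level at most \<open>J\<close> and are unions of intervals of level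
  \<open>J\<close>.\<close>

lemma haar_cong_floor:
  assumes "1 \<le> i" "i \<le> 2 ^ J" "\<lfloor>2 ^ J * s\<rfloor> = \<lfloor>2 ^ J * t\<rfloor>"
  shows "haar i s = haar i t"
  using assms(1)
proof (cases rule: haar_index_cases)
  case scaling
  then show ?thesis
    using assms(3) floor_dyad_coarse[of 0 J s] floor_dyad_coarse[of 0 J t]
    by (simp add: haar_1 indicator_def mem_dyad_iff del: One_nat_def)
next
  case (wavelet j k)
  then have "Suc j \<le> J" using assms(2) wavelet_index_le_iff by auto
  then have "\<lfloor>2 ^ Suc j * s\<rfloor> = \<lfloor>2 ^ Suc j * t\<rfloor>"
    using assms(3) floor_dyad_coarse[of "Suc j" J] by metis
  then show ?thesis
    by (simp only: wavelet haar_Suc indicator_def mem_dyad_iff)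
qed

text \<open>The coarser function is constant on the support of the finer wavelet. Its value there is
  read off at the midpoint, which is exactly the sampling point in \<open>haar_mat\<close>; off the
  support both sides vanish.\<close>

lemma haar_mult_finer:
  assumes "1 \<le> i" "i \<le> 2 ^ j" "k < 2 ^ j"
  shows "haar i t * haar (2 ^ j + k + 1) t = haar i ((real k + 1/2) / 2 ^ j) * haar (2 ^ j + k + 1) t"
proof (cases "t \<in> dyad j k")
  case True
  have "\<lfloor>real k + 1 / 2\<rfloor> = int k" by (rule floor_unique) auto
  then have "haar i t = haar i ((real k + 1/2) / 2 ^ j)"
    using True assms by (intro haar_cong_floor[of i j]) (auto simp: mem_dyad_iff)
  then show ?thesis by simp
qed (use haar_eq_0[OF assms(3)] in simp)

lemma haar_mult_same_level:
  assumes "k < 2 ^ j" "k' < 2 ^ j" "k \<noteq> k'"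
  shows "haar (2 ^ j + k + 1) t * haar (2 ^ j + k' + 1) t = 0"
  using haar_eq_0[OF assms(1), of t] haar_eq_0[OF assms(2), of t] assms(3)
  unfolding mem_dyad_iff mult_eq_0_iff by linarith

section \<open>Sums over one level and the reproducing kernel\<close>

lemma sum_upto_level_Suc:
  "(\<Sum>i\<in>{1..2 ^ Suc J}. g i) = (\<Sum>i\<in>{1..2 ^ J}. g i) + (\<Sum>k<2 ^ J. g (2 ^ J + k + 1 :: nat))"
proof -
  have "{1..2 ^ Suc J} = {1..2 ^ J} \<union> (\<lambda>k. 2 ^ J + k + 1) ` {..<(2::nat) ^ J}"
    (is "_ = _ \<union> ?B")
  proof (intro equalityI subsetI)
    fix i :: nat assume i: "i \<in> {1..2 ^ Suc J}"
    show "i \<in> {1..2 ^ J} \<union> ?B"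
    proof (cases "i \<le> 2 ^ J")
      case False
      then have "i = 2 ^ J + (i - 2 ^ J - 1) + 1" "i - 2 ^ J - 1 < 2 ^ J" using i by auto
      then show ?thesis by blast
    qed (use i in auto)
  qed auto
  moreover have "(\<Sum>i\<in>?B. g i) = (\<Sum>k<2 ^ J. g (2 ^ J + k + 1))"
    by (subst sum.reindex) (auto simp: inj_on_def)
  moreover have "sum g ({1..2 ^ J} \<union> ?B) = sum g {1..2 ^ J} + sum g ?B"
    by (rule sum.union_disjoint) auto
  ultimately show ?thesis by simp
qed

text \<open>A point of [0, 1) lies in exactly one interval of each level, so a sum over a level
  collapses to one term. The point 1 is excluded because it lies in no interval of index below
  \<open>2 ^ J\<close>.\<close>

lemma sum_level_haar:
  fixes t :: real and J :: nat
  assumes "t \<in> {0..<1}"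
  defines "K \<equiv> nat \<lfloor>2 ^ J * t\<rfloor>"
  shows "K < 2 ^ J" "t \<in> dyad J K"
    and "(\<And>k. k < 2 ^ J \<Longrightarrow> t \<notin> dyad J k \<Longrightarrow> g k = 0) \<Longrightarrow> (\<Sum>k<2 ^ J. g k) = (g K :: real)"
proof -
  have "2 ^ J * t < 2 ^ J" using assms by simp
  then have "\<lfloor>2 ^ J * t\<rfloor> < 2 ^ J" by (simp add: floor_less_iff)
  moreover have "0 \<le> \<lfloor>2 ^ J * t\<rfloor>" using assms by simp
  ultimately have K: "int K = \<lfloor>2 ^ J * t\<rfloor>" "int K < 2 ^ J" by (simp_all add: K_def)
  from K(2) have *: "K < 2 ^ J" by simp
  then show "K < 2 ^ J" by simp
  show "t \<in> dyad J K" using K by (simp add: mem_dyad_iff)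
  assume g: "\<And>k. k < 2 ^ J \<Longrightarrow> t \<notin> dyad J k \<Longrightarrow> g k = 0"
  have "(\<Sum>k<2 ^ J. g k) = (\<Sum>k\<in>{K}. g k)"
    using * K(1) g by (intro sum.mono_neutral_right) (auto simp: mem_dyad_iff)
  then show "(\<Sum>k<2 ^ J. g k) = g K" by simp
qed

text \<open>This is the kernel of the projection onto functions constant on the intervals of level
  \<open>J\<close>. Adding level \<open>J\<close> contributes \<open>2 ^ J\<close> if both points
  are in the same half of an interval, \<open>- (2 ^ J)\<close> if they are in opposite halves, and
  0 if they are in different intervals; so the kernel doubles or is cancelled.\<close>

lemma haar_kernel:
  assumes s: "s \<in> {0..<1}" and t: "t \<in> {0..<1}"
  shows "(\<Sum>i\<in>{1..2 ^ J}. haar i s * haar i t) = 2 ^ J * (if \<lfloor>2 ^ J * s\<rfloor> = \<lfloor>2 ^ J * t\<rfloor> then 1 else 0)"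
proof (induction J)
  case 0
  have "\<lfloor>s\<rfloor> = 0" "\<lfloor>t\<rfloor> = 0" using s t by (auto simp: floor_eq_iff)
  then show ?case using s t by (simp add: haar_def)
next
  case (Suc J)
  define K where "K = nat \<lfloor>2 ^ J * t\<rfloor>"
  note K = sum_level_haar[OF t, of J, folded K_def]
  have fl: "\<lfloor>2 ^ J * s\<rfloor> = \<lfloor>2 ^ Suc J * s\<rfloor> div 2" "\<lfloor>2 ^ J * t\<rfloor> = \<lfloor>2 ^ Suc J * t\<rfloor> div 2"
    by (rule floor_dyad_Suc)+
  have KJ: "\<lfloor>2 ^ J * t\<rfloor> = int K" using K(2) by (simp add: mem_dyad_iff)
  have "(\<Sum>k<2 ^ J. haar (2 ^ J + k + 1) s * haar (2 ^ J + k + 1) t)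
      = haar (2 ^ J + K + 1) s * haar (2 ^ J + K + 1) t"
    by (rule K(3)) (use haar_eq_0 in simp)
  also have "\<dots> = 2 ^ J * ((indicator (dyad (Suc J) (2 * K)) s - indicator (dyad (Suc J) (2 * K + 1)) s)
      * (indicator (dyad (Suc J) (2 * K)) t - indicator (dyad (Suc J) (2 * K + 1)) t))"
    unfolding haar_Suc[OF K(1)] powr_half_mult_self[symmetric] by (simp only: mult_ac)
  finally have "(\<Sum>i\<in>{1..2 ^ Suc J}. haar i s * haar i t) =
      2 ^ J * ((if \<lfloor>2 ^ J * s\<rfloor> = \<lfloor>2 ^ J * t\<rfloor> then 1 else 0)
      + (indicator (dyad (Suc J) (2 * K)) s - indicator (dyad (Suc J) (2 * K + 1)) s)
      * (indicator (dyad (Suc J) (2 * K)) t - indicator (dyad (Suc J) (2 * K + 1)) t))"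
    by (simp only: sum_upto_level_Suc Suc.IH distrib_left)
  also have "\<dots> = 2 ^ J * (2 * (if \<lfloor>2 ^ Suc J * s\<rfloor> = \<lfloor>2 ^ Suc J * t\<rfloor> then 1 else 0))"
  proof -
    \<comment> \<open>\<open>t\<close> lies in one of the two halves of interval \<open>K\<close>;
      \<open>s\<close> lies in either half or outside.\<close>
    define x y where "x = \<lfloor>2 ^ Suc J * s\<rfloor>" and "y = \<lfloor>2 ^ Suc J * t\<rfloor>"
    have "y = 2 * int K \<or> y = 2 * int K + 1"
      using KJ fl unfolding y_def by presburger
    moreover have "x = 2 * int K \<or> x = 2 * int K + 1 \<or> x div 2 \<noteq> int K \<and> x \<noteq> 2 * int K \<and> x \<noteq> 2 * int K + 1"
      by presburger
    ultimately show ?thesis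
      unfolding indicator_def mem_dyad_iff fl x_def[symmetric] y_def[symmetric] by auto
  qed
  finally show ?case by simp
qed

section \<open>Entries of the block matrices\<close>

text \<open>Closed form of the recursive blocks with 0-based indices: the column alone fixes the
  level at which its entries enter. Column 0 belongs to the scaling function, which has no level,
  and is set apart.\<close>

definition tilde_entry :: "nat \<Rightarrow> nat \<Rightarrow> real" where
  "tilde_entry p q = (if q = 0 then 0 else
     if p < 2 ^ floor_log q then haar (p + 1) ((real (q - 2 ^ floor_log q) + 1/2) / 2 ^ floor_log q)
     else 0)"

lemma two_power_block_cases:
  fixes q :: nat
  assumes "q < 2 ^ Suc j"
  obtains "q < 2 ^ j" | "2 ^ j \<le> q" "floor_log q = j" "q - 2 ^ j < 2 ^ j"
proof (cases "q < 2 ^ j")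
  case False
  moreover have "floor_log q = j" by (rule floor_log_eqI) (use False assms in auto)
  ultimately show thesis using that(2) assms by simp
qed (use that(1) in blast)

lemma index_Omega_tilde_block:
  "p < 2 ^ J \<Longrightarrow> q < 2 ^ J \<Longrightarrow> Omega_tilde_block J $$ (p, q) = tilde_entry p q"
proof (induction J)
  case (Suc J)
  \<comment> \<open>Nonzero entries of column \<open>q\<close> lie in rows below
    \<open>2 ^ floor_log q\<close>, which is at most \<open>q\<close>; hence the lower left block
    vanishes.\<close>
  have left: "tilde_entry p q = 0" if "2 ^ J \<le> p" "q < 2 ^ J"
  proof (cases "q = 0")
    case False
    then have "2 ^ floor_log q \<le> q" using floor_log_exp2_le[of q] by simp
    then show ?thesis using that by (simp add: tilde_entry_def)
  qed (simp add: tilde_entry_def)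
  show ?case
    using Suc.prems(2)
  proof (cases rule: two_power_block_cases)
    case 1
    then show ?thesis using Suc left
      by (auto simp: carrier_matD[OF Omega_tilde_block_carrier])
  next
    case 2
    then have "0 < q" using zero_less_power[of "2::nat" J] by linarith
    then show ?thesis using Suc.prems 2
      by (auto simp: carrier_matD[OF Omega_tilde_block_carrier] tilde_entry_def haar_mat_def)
  qed
qed (simp add: tilde_entry_def)

text \<open>Column \<open>l\<close> of \<open>Upsilon\<close> carries the wavelet
  \<open>m + l\<close>, and \<open>m + l\<close> is also the position of that column in the doubled
  matrix. Hence the two recursions differ only by a scaling of columns.\<close>

lemma index_Omega_block:
  "p < 2 ^ J \<Longrightarrow> q < 2 ^ J \<Longrightarrow> Omega_block t J $$ (p, q) = Omega_tilde_block J $$ (p, q) * haar (q + 1) t"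
  by (induction J)
     (auto simp: carrier_matD[OF Omega_tilde_block_carrier] carrier_matD[OF Omega_block_carrier]
        Upsilon_def haar_mat_def)

text \<open>The recursion for Gamma is the transpose of the one for
  \<open>Omega_tilde_block\<close>; only the starting value differs, and it stays in the
  corner.\<close>

lemma index_Gamma_block:
  "p < 2 ^ J \<Longrightarrow> q < 2 ^ J \<Longrightarrow>
    Gamma_block J $$ (p, q) = Omega_tilde_block J $$ (q, p) + (if p = 0 \<and> q = 0 then 1 else 0)"
  by (induction J)
     (auto simp: carrier_matD[OF Omega_tilde_block_carrier] carrier_matD[OF Gamma_block_carrier]
        haar_mat_def)

section \<open>Entries of the infinite matrices and the product rule for wavelets\<close>

lemma entry_of_leading_block:
  assumes "leading_block n N = B" "1 \<le> i" "i \<le> n" "1 \<le> l" "l \<le> n"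
  shows "N i l = B $$ (i - 1, l - 1)"
  using assms(2-) by (auto simp: leading_block_def simp flip: assms(1))

lemma Omega_tilde_eq:
  assumes "1 \<le> i" "1 \<le> l"
  shows "Omega_tilde i l = tilde_entry (i - 1) (l - 1)"
proof -
  \<comment> \<open>A convenient block size that contains both indices.\<close>
  have "i \<le> 2 ^ (i + l)" "l \<le> 2 ^ (i + l)"
    using less_exp[of "i + l"] by linarith+
  then show ?thesis
    using assms index_Omega_tilde_block[of "i - 1" "i + l" "l - 1"]
    by (subst entry_of_leading_block[OF leading_block_Omega_tilde[of "i + l"]]) auto
qed

lemma Omega_eq:
  assumes "1 \<le> i" "1 \<le> l"
  shows "Omega t i l = Omega_tilde i l * haar l t"
proof -
  have le: "i \<le> 2 ^ (i + l)" "l \<le> 2 ^ (i + l)"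
    using less_exp[of "i + l"] by linarith+
  then have "i - 1 < 2 ^ (i + l)" "l - 1 < 2 ^ (i + l)" using assms by linarith+
  from index_Omega_block[OF this, of t] assms show ?thesis
    by (simp add: entry_of_leading_block[OF leading_block_Omega[of "i + l"] assms(1) le(1) assms(2) le(2)]
        entry_of_leading_block[OF leading_block_Omega_tilde[of "i + l"] assms(1) le(1) assms(2) le(2)])
qed

lemma Gamma_mat_eq:
  assumes "1 \<le> i" "1 \<le> l"
  shows "Gamma_mat i l = Omega_tilde l i + (if i = 1 \<and> l = 1 then 1 else 0)"
proof -
  have le: "i \<le> 2 ^ (i + l)" "l \<le> 2 ^ (i + l)"
    using less_exp[of "i + l"] by linarith+
  then have "i - 1 < 2 ^ (i + l)" "l - 1 < 2 ^ (i + l)" using assms by linarith+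
  from index_Gamma_block[OF this] assms show ?thesis
    by (simp add: entry_of_leading_block[OF leading_block_Gamma[of "i + l"] assms(1) le(1) assms(2) le(2)]
        entry_of_leading_block[OF leading_block_Omega_tilde[of "i + l"] assms(2) le(2) assms(1) le(1)])
qed

lemma Omega_tilde_1: "1 \<le> i \<Longrightarrow> Omega_tilde i 1 = 0"
  using Omega_tilde_eq[of i 1] by (simp add: tilde_entry_def)

lemma Omega_tilde_Suc:
  assumes "1 \<le> i" "k < 2 ^ j"
  shows "Omega_tilde i (2 ^ j + k + 1) = (if i \<le> 2 ^ j then haar i ((real k + 1/2) / 2 ^ j) else 0)"
proof -
  have "floor_log (2 ^ j + k) = j"
    by (rule floor_log_eqI) (use assms in auto)
  moreover have "i - 1 < 2 ^ j \<longleftrightarrow> i \<le> 2 ^ j" using assms by linarith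
  ultimately show ?thesis
    using assms Omega_tilde_eq[of i "2 ^ j + k + 1"] by (simp add: tilde_entry_def)
qed

lemma Omega_1: "1 \<le> i \<Longrightarrow> Omega t i 1 = 0"
  using Omega_eq[of i 1 t] Omega_tilde_1[of i] by simp

text \<open>By \<open>haar_mult_finer\<close> the sampled value times the finer wavelet is the
  pointwise product of both functions.\<close>

lemma Omega_Suc:
  assumes "1 \<le> i" "k < 2 ^ j"
  shows "Omega t i (2 ^ j + k + 1) =
    (if i \<le> 2 ^ j then haar i t * haar (2 ^ j + k + 1) t else 0)"
  using assms haar_mult_finer[OF assms(1) _ assms(2), of t]
    Omega_eq[of i "2 ^ j + k + 1" t] Omega_tilde_Suc[OF assms]
  by auto

lemma abs_Omega_le:
  assumes "1 \<le> i" "1 \<le> l"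
  shows "\<bar>Omega t i l\<bar> \<le> \<bar>haar i t\<bar> * \<bar>haar l t\<bar>"
  using assms(2)
proof (cases rule: haar_index_cases)
  case scaling
  then show ?thesis using Omega_1[OF assms(1), of t] by simp
next
  case (wavelet j k)
  then show ?thesis using Omega_Suc[OF assms(1) wavelet(1), of t] by (simp add: abs_mult)
qed

text \<open>Comparison of levels, with the scaling function counted as coarser than every wavelet:
  \<open>Omega\<close> takes the pairs whose first member is coarser, its transpose those whose
  second is, \<open>Theta\<close> the diagonal. Distinct wavelets of equal level appear in none of
  them and have product zero.\<close>

lemma haar_mult_eq_Omega_Theta:
  assumes "1 \<le> i" "1 \<le> l"
  shows "haar i t * haar l t = Omega t i l + transp_inf (Omega t) i l + Theta t i l"
  using assms(1)
proof (cases rule: haar_index_cases)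
  case i: scaling
  from assms(2) show ?thesis
  proof (cases rule: haar_index_cases)
    case scaling
    then show ?thesis
      using i Omega_1[of 1 t] by (simp add: transp_inf_def Theta_def power2_eq_square)
  next
    case (wavelet j k)
    then show ?thesis
      using i Omega_1[of l t] Omega_Suc[of 1 k j t] assms by (simp add: transp_inf_def Theta_def)
  qed
next
  case i: (wavelet j k)
  from assms(2) show ?thesis
  proof (cases rule: haar_index_cases)
    case scaling
    then show ?thesis
      using i Omega_1[of i t] Omega_Suc[of 1 k j t] assms by (simp add: transp_inf_def Theta_def)
  next
    case l: (wavelet j' k')
    have O1: "Omega t i l = (if j < j' then haar i t * haar l t else 0)"
      using Omega_Suc[OF assms(1) l(1), of t] wavelet_index_le_iff[OF i(1), of j'] i l by simp
    have O2: "Omega t l i = (if j' < j then haar i t * haar l t else 0)"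
      using Omega_Suc[OF assms(2) i(1), of t] wavelet_index_le_iff[OF l(1), of j] i l by simp
    consider "j < j'" | "j' < j" | "j = j'" "k \<noteq> k'" | "j = j'" "k = k'" by linarith
    then show ?thesis
    proof cases
      case 1
      then have "i \<noteq> l" using O1 wavelet_index_le_iff[OF i(1), of j'] i l by auto
      then show ?thesis using 1 O1 O2 by (simp add: transp_inf_def Theta_def)
    next
      case 2
      then have "i \<noteq> l" using O2 wavelet_index_le_iff[OF l(1), of j] i l by auto
      then show ?thesis using 2 O1 O2 by (simp add: transp_inf_def Theta_def)
    next
      case 3
      then have "haar i t * haar l t = 0"
        using haar_mult_same_level[of k j k' t] i l by simp
      moreover have "i \<noteq> l" using 3 i l by simp
      ultimately show ?thesis using 3 O1 O2 by (simp add: transp_inf_def Theta_def)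
    next
      case 4
      then show ?thesis using O1 O2 i l by (simp add: transp_inf_def Theta_def power2_eq_square)
    qed
  qed
qed

section \<open>Orthonormality and Bessel's inequality\<close>

abbreviation (input) unit_lebesgue :: "real measure" where
  "unit_lebesgue \<equiv> lebesgue_on {0..1}"

interpretation unit_lebesgue: finite_measure unit_lebesgue
  by (rule finite_measure_lebesgue_on) auto

lemma borel_measurable_unit_lebesgue [measurable (raw)]:
  "f \<in> borel_measurable borel \<Longrightarrow> f \<in> borel_measurable unit_lebesgue"
  by (intro measurable_restrict_space1 measurable_completion) simp

lemma measurable_haar [measurable]: "haar i \<in> borel_measurable borel"
  unfolding haar_def [abs_def] haar_wavelet_def by measurable

lemma measurable_haar_unit [measurable]: "haar i \<in> borel_measurable unit_lebesgue"
  by (intro borel_measurable_unit_lebesgue measurable_haar)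

lemma integrable_unit_bounded:
  fixes f :: "real \<Rightarrow> real"
  assumes "f \<in> borel_measurable unit_lebesgue" "\<And>t. t \<in> {0..1} \<Longrightarrow> \<bar>f t\<bar> \<le> K"
  shows "integrable unit_lebesgue f"
  using assms by (intro unit_lebesgue.integrable_const_bound[of _ K] AE_I2) auto

text \<open>The interval has measure 1, so a pointwise bound passes to the norm with the same
  constant.\<close>

lemma bounded_in_L2_01:
  assumes f: "f \<in> borel_measurable unit_lebesgue" and bd: "\<And>t. t \<in> {0..1} \<Longrightarrow> \<bar>f t\<bar> \<le> K"
  shows "f \<in> L2_01" and "L2_01_norm f \<le> K"
proof -
  have K: "0 \<le> K" using bd[of 0] by simp
  have sq: "(f t)\<^sup>2 \<le> K\<^sup>2" if "t \<in> {0..1}" for t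
    using bd[OF that] K by (metis abs_ge_zero power2_abs power_mono)
  have int: "integrable unit_lebesgue (\<lambda>t. (f t)\<^sup>2)"
    by (rule integrable_unit_bounded[of _ "K\<^sup>2"]) (use f sq in auto)
  then show "f \<in> L2_01" using f by (simp add: L2_01_def)
  have "(LINT t|unit_lebesgue. (f t)\<^sup>2) \<le> (LINT t|unit_lebesgue. K\<^sup>2)"
    by (rule integral_mono) (use int sq in auto)
  also have "\<dots> = K\<^sup>2" by (simp add: measure_restrict_space)
  finally show "L2_01_norm f \<le> K"
    unfolding L2_01_norm_def using K by (intro real_le_lsqrt) auto
qed

lemma haar_bounded:
  assumes "1 \<le> i"
  obtains B where "0 \<le> B" "\<And>t. \<bar>haar i t\<bar> \<le> B"
  using assms
proof (cases rule: haar_index_cases)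
  case scaling
  then show ?thesis by (intro that[of 1]) (auto simp: haar_def)
next
  case (wavelet j k)
  then show ?thesis
    by (intro that[of "2 powr (real j / 2)"]) (auto simp: abs_haar[simplified] indicator_def)
qed

section \<open>Integrals of products of two and three wavelets\<close>

lemma measurable_dyad [measurable]: "dyad j k \<in> sets borel"
  by (simp add: dyad_def)

lemma measure_dyad:
  assumes "k < 2 ^ j"
  shows "measure unit_lebesgue (dyad j k \<inter> {0..1}) = 1 / 2 ^ j"
proof -
  have "k + 1 \<le> 2 ^ j" using assms by simp
  then have "real (k + 1) \<le> real (2 ^ j)" by (simp only: of_nat_le_iff)
  then have "real k + 1 \<le> 2 ^ j" by simp
  then have "(real k + 1) / 2 ^ j \<le> 1" by simp
  then have "dyad j k \<subseteq> {0..1}"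
    unfolding dyad_def atLeastLessThan_subseteq_atLeastAtMost_iff by simp
  then have "measure unit_lebesgue (dyad j k \<inter> {0..1}) = measure lborel (dyad j k)"
    by (simp add: measure_restrict_space Int_absorb2)
  also have "\<dots> = 1 / 2 ^ j"
    by (simp add: dyad_def measure_def divide_right_mono flip: diff_divide_distrib)
  finally show ?thesis .
qed

lemma integrable_indicator_dyad: "integrable unit_lebesgue (indicat_real (dyad j k))"
  by (rule integrable_unit_bounded[of _ 1]) (auto simp: indicator_def)

lemma integrable_haar: "1 \<le> i \<Longrightarrow> integrable unit_lebesgue (haar i)"
  by (metis haar_bounded integrable_unit_bounded measurable_haar_unit)

lemma integral_haar_1: "integral\<^sup>L unit_lebesgue (haar 1) = 1"
  unfolding haar_1[abs_def] using measure_dyad[of 0 0] by simp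

lemma integral_haar_Suc:
  assumes "k < 2 ^ j"
  shows "integral\<^sup>L unit_lebesgue (haar (2 ^ j + k + 1)) = 0"
  unfolding haar_Suc[OF assms, abs_def]
  using measure_dyad[of "2 * k" "Suc j"] measure_dyad[of "2 * k + 1" "Suc j"] assms
  by (simp add: integrable_indicator_dyad)

text \<open>Only the scaling function has nonzero mean, and its column in \<open>Omega_tilde\<close>
  is zero.\<close>

lemma Omega_tilde_mult_integral_haar:
  assumes "1 \<le> i" "1 \<le> l"
  shows "Omega_tilde i l * integral\<^sup>L unit_lebesgue (haar l) = 0"
  using assms(2)
  by (cases rule: haar_index_cases) (use Omega_tilde_1[OF assms(1)] integral_haar_Suc in \<open>simp_all del: One_nat_def\<close>)

lemma integral_haar_power2:
  assumes "1 \<le> i"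
  shows "(LINT t|unit_lebesgue. (haar i t)\<^sup>2) = 1"
  using assms
proof (cases rule: haar_index_cases)
  case scaling
  have "(LINT t|unit_lebesgue. (haar 1 t)\<^sup>2) = (LINT t|unit_lebesgue. haar 1 t)"
    by (intro Bochner_Integration.integral_cong) (auto simp: haar_def)
  then show ?thesis using integral_haar_1 scaling by simp
next
  case (wavelet j k)
  then show ?thesis
    using measure_dyad[of k j] haar_power2[OF wavelet(1)] by simp
qed

lemma integrable_haar_mult:
  assumes "1 \<le> i" "1 \<le> l"
  shows "integrable unit_lebesgue (\<lambda>t. haar i t * haar l t)"
proof -
  obtain B where B: "0 \<le> B" "\<And>t. \<bar>haar i t\<bar> \<le> B" using haar_bounded[OF assms(1)] by blast
  obtain B' where B': "0 \<le> B'" "\<And>t. \<bar>haar l t\<bar> \<le> B'" using haar_bounded[OF assms(2)] by blast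
  show ?thesis
    by (rule integrable_unit_bounded[of _ "B * B'"]) (use B B' in \<open>auto simp: abs_mult intro!: mult_mono\<close>)
qed

text \<open>Linearises the product: for distinct indices it is a combination of the two factors with
  constant coefficients. Orthogonality and the triple integrals both reduce to simpler integrals in
  this way.\<close>

lemma haar_mult_expand:
  assumes "1 \<le> i" "1 \<le> l"
  shows "haar i t * haar l t =
    Omega_tilde i l * haar l t + Omega_tilde l i * haar i t + (if i = l then (haar i t)\<^sup>2 else 0)"
  using haar_mult_eq_Omega_Theta[OF assms, of t] Omega_eq[OF assms, of t] Omega_eq[OF assms(2,1), of t]
  by (simp add: transp_inf_def Theta_def)

lemma haar_orthonormal:
  assumes "1 \<le> i" "1 \<le> l"
  shows "(LINT t|unit_lebesgue. haar i t * haar l t) = (if i = l then 1 else 0)"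
proof (cases "i = l")
  case True
  then show ?thesis using integral_haar_power2[OF assms(1)] by (simp add: power2_eq_square)
next
  case False
  then have "(LINT t|unit_lebesgue. haar i t * haar l t)
      = (LINT t|unit_lebesgue. Omega_tilde i l * haar l t + Omega_tilde l i * haar i t)"
    using haar_mult_expand[OF assms] by simp
  also have "\<dots> = 0"
    using integrable_haar assms Omega_tilde_mult_integral_haar[OF assms]
      Omega_tilde_mult_integral_haar[OF assms(2,1)]
    by (subst Bochner_Integration.integral_add) auto
  finally show ?thesis using False by simp
qed

text \<open>Each entry of \<open>Omega\<close> is a constant times one wavelet, so orthonormality
  selects \<open>l = n\<close>.\<close>

lemma integral_Omega_haar:
  assumes "1 \<le> i" "1 \<le> l" "1 \<le> n"
  shows "(LINT t|unit_lebesgue. Omega t i l * haar n t) = (if l = n then Omega_tilde i n else 0)"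
  using Omega_eq[OF assms(1,2)] haar_orthonormal[OF assms(2,3)] by (simp add: mult.assoc)

lemma Omega_tilde_diag: "1 \<le> i \<Longrightarrow> Omega_tilde i i = 0"
  by (erule haar_index_cases) (use Omega_tilde_1 Omega_tilde_Suc in auto)

lemma haar_power3:
  assumes "k < 2 ^ j"
  shows "(haar (2 ^ j + k + 1) t)\<^sup>2 * haar (2 ^ j + k + 1) t = 2 ^ j * haar (2 ^ j + k + 1) t"
  using haar_power2[OF assms, of t] haar_eq_0[OF assms, of t] by (auto simp: indicator_def)

lemma integral_haar_power3:
  assumes "1 \<le> i"
  shows "(LINT t|unit_lebesgue. (haar i t)\<^sup>2 * haar i t) = (if i = 1 then 1 else 0)"
  using assms
proof (cases rule: haar_index_cases)
  case scaling
  have "(LINT t|unit_lebesgue. (haar 1 t)\<^sup>2 * haar 1 t) = (LINT t|unit_lebesgue. haar 1 t)"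
    by (intro Bochner_Integration.integral_cong) (auto simp: haar_def)
  then show ?thesis using integral_haar_1 scaling by simp
next
  case (wavelet j k)
  have "(LINT t|unit_lebesgue. (haar i t)\<^sup>2 * haar i t) = 2 ^ j * (LINT t|unit_lebesgue. haar i t)"
    unfolding wavelet(2) haar_power3[OF wavelet(1)] by simp
  also have "(LINT t|unit_lebesgue. haar i t) = 0"
    unfolding wavelet(2) by (rule integral_haar_Suc[OF wavelet(1)])
  finally show ?thesis using wavelet by simp
qed

text \<open>Identifies Gamma as the matrix of Haar coefficients of the squared wavelets. Off the
  diagonal, linearising the product and using orthonormality leaves \<open>Omega_tilde n i\<close>;
  on the diagonal the cube of a wavelet has mean zero, and the scaling function supplies the initial
  1.\<close>

lemma integral_haar_power2_haar:
  assumes "1 \<le> i" "1 \<le> n"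
  shows "(LINT t|unit_lebesgue. (haar i t)\<^sup>2 * haar n t) = Gamma_mat i n"
proof (cases "i = n")
  case True
  then show ?thesis
    using integral_haar_power3[OF assms(1)] Gamma_mat_eq[OF assms] Omega_tilde_diag[OF assms(1)] by auto
next
  case False
  have "(haar i t)\<^sup>2 * haar n t = Omega_tilde i n * (haar i t * haar n t) + Omega_tilde n i * (haar i t * haar i t)" for t
  proof -
    have "(haar i t)\<^sup>2 * haar n t = haar i t * (haar i t * haar n t)"
      by (simp add: power2_eq_square)
    also have "\<dots> = haar i t * (Omega_tilde i n * haar n t + Omega_tilde n i * haar i t)"
      using haar_mult_expand[OF assms, of t] False by simp
    finally show ?thesis by (simp add: algebra_simps)
  qed
  then have "(LINT t|unit_lebesgue. (haar i t)\<^sup>2 * haar n t) =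
      Omega_tilde i n * (LINT t|unit_lebesgue. haar i t * haar n t)
      + Omega_tilde n i * (LINT t|unit_lebesgue. haar i t * haar i t)"
    using integrable_haar_mult assms by simp
  then show ?thesis
    using False haar_orthonormal assms Gamma_mat_eq[OF assms] by auto
qed

section \<open>Bessel's inequality for bounded functions\<close>

lemma integrable_mult_haar:
  assumes "f \<in> borel_measurable unit_lebesgue" "\<And>t. t \<in> {0..1} \<Longrightarrow> \<bar>f t\<bar> \<le> K" "1 \<le> i"
  shows "integrable unit_lebesgue (\<lambda>t. f t * haar i t)"
proof -
  have [measurable]: "f \<in> borel_measurable unit_lebesgue" by fact
  obtain B where B: "0 \<le> B" "\<And>t. \<bar>haar i t\<bar> \<le> B" using haar_bounded[OF assms(3)] by blast
  have "0 \<le> K" using assms(2)[of 0] by simp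
  then show ?thesis
    by (intro integrable_unit_bounded[of _ "K * B"]) (use assms B in \<open>auto simp: abs_mult intro!: mult_mono\<close>)
qed

text \<open>Expand the nonnegative integral of \<open>(f t - p t)\<^sup>2\<close> for the partial
  sum \<open>p\<close>: by orthonormality the integrals of \<open>f t * p t\<close> and
  \<open>p t * p t\<close> both equal the sum of squared coefficients.\<close>

lemma bessel_haar:
  assumes [measurable]: "f \<in> borel_measurable unit_lebesgue"
    and bd: "\<And>t. t \<in> {0..1} \<Longrightarrow> \<bar>f t\<bar> \<le> K"
    and S: "finite S" "S \<subseteq> {1..}"
  shows "(\<Sum>i\<in>S. (haar_transform f i)\<^sup>2) \<le> (LINT t|unit_lebesgue. (f t)\<^sup>2)"
proof -
  define u where "u = haar_transform f"
  define p where "p t = (\<Sum>i\<in>S. u i * haar i t)" for t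
  have S1: "1 \<le> i" if "i \<in> S" for i using that S by auto
  have int_f2: "integrable unit_lebesgue (\<lambda>t. (f t)\<^sup>2)"
    using bounded_in_L2_01(1)[OF assms(1) bd] by (simp add: L2_01_def)
  have int_fh: "integrable unit_lebesgue (\<lambda>t. f t * haar i t)" if "i \<in> S" for i
    using integrable_mult_haar[OF assms(1) bd S1[OF that]] .
  have fp_eq: "f t * p t = (\<Sum>i\<in>S. u i * (f t * haar i t))" for t
    by (simp add: p_def sum_distrib_left mult_ac)
  have pp_eq: "p t * p t = (\<Sum>i\<in>S. \<Sum>l\<in>S. u i * u l * (haar i t * haar l t))" for t
    by (simp add: p_def sum_product mult_ac)
  have int_fp: "integrable unit_lebesgue (\<lambda>t. f t * p t)"
    unfolding fp_eq using int_fh by auto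
  have int_pp: "integrable unit_lebesgue (\<lambda>t. p t * p t)"
    unfolding pp_eq using integrable_haar_mult S1 by auto
  have "(LINT t|unit_lebesgue. f t * p t) = (\<Sum>i\<in>S. u i * u i)"
    unfolding fp_eq using int_fh by (simp add: u_def haar_transform_def)
  moreover have "(LINT t|unit_lebesgue. p t * p t) = (\<Sum>i\<in>S. u i * u i)"
  proof -
    have "(LINT t|unit_lebesgue. p t * p t) =
        (\<Sum>i\<in>S. \<Sum>l\<in>S. u i * u l * (LINT t|unit_lebesgue. haar i t * haar l t))"
      unfolding pp_eq using integrable_haar_mult S1 by simp
    also have "\<dots> = (\<Sum>i\<in>S. \<Sum>l\<in>S. u i * u l * (if i = l then 1 else 0))"
      using haar_orthonormal S1 by (intro sum.cong refl) auto
    also have "\<dots> = (\<Sum>i\<in>S. u i * u i)"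
      using S(1) by (simp add: if_distrib cong: if_cong)
    finally show ?thesis .
  qed
  moreover have "0 \<le> (LINT t|unit_lebesgue. (f t - p t)\<^sup>2)" by simp
  moreover have "(LINT t|unit_lebesgue. (f t - p t)\<^sup>2) = (LINT t|unit_lebesgue. (f t)\<^sup>2)
      - 2 * (LINT t|unit_lebesgue. f t * p t) + (LINT t|unit_lebesgue. p t * p t)"
  proof -
    have "(f t - p t)\<^sup>2 = (f t)\<^sup>2 - 2 * (f t * p t) + p t * p t" for t
      by (simp add: power2_eq_square algebra_simps)
    then show ?thesis using int_f2 int_fp int_pp by simp
  qed
  ultimately have "(\<Sum>i\<in>S. u i * u i) \<le> (LINT t|unit_lebesgue. (f t)\<^sup>2)" by linarith
  then show ?thesis by (simp add: u_def power2_eq_square)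
qed

section \<open>The primitive of a Haar series\<close>

lemma haar_w_eq_transform:
  assumes "t \<in> {0..1}"
  shows "haar_w i t = haar_transform (indicator {0..t}) i"
proof -
  have "haar_w i t = (LINT x|lebesgue. indicator {0..t} x * haar i x)"
    unfolding haar_w_def by (subst integral_restrict_space) auto
  also have "\<dots> = (LINT x|lebesgue. indicator {0..1} x *\<^sub>R (indicator {0..t} x * haar i x))"
    using assms by (intro Bochner_Integration.integral_cong) (auto simp: indicator_def)
  also have "\<dots> = haar_transform (indicator {0..t}) i"
    unfolding haar_transform_def by (subst integral_restrict_space) auto
  finally show ?thesis .
qed

lemma haar_w_diff_eq_transform:
  assumes "0 \<le> s" "s \<le> t" "t \<le> 1" "1 \<le> i"
  shows "haar_w i t - haar_w i s = haar_transform (indicator {s<..t}) i"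
proof -
  have int: "integrable unit_lebesgue (\<lambda>x. indicator {0..r} x * haar i x)" for r
    using assms(4) by (intro integrable_mult_haar[of _ 1]) (auto simp: indicator_def)
  have "haar_w i t - haar_w i s =
      (LINT x|unit_lebesgue. indicator {0..t} x * haar i x - indicator {0..s} x * haar i x)"
    using assms int by (simp add: haar_w_eq_transform haar_transform_def)
  also have "\<dots> = haar_transform (indicator {s<..t}) i"
    unfolding haar_transform_def
    using assms by (intro Bochner_Integration.integral_cong) (auto simp: indicator_def)
  finally show ?thesis .
qed

text \<open>Bessel's inequality for the indicator of (s, t], whose squared norm is the length of the
  interval.\<close>

lemma sum_haar_w_diff_power2_le:
  assumes "s \<in> {0..1}" "t \<in> {0..1}" "finite S" "S \<subseteq> {1..}"
  shows "(\<Sum>i\<in>S. (haar_w i t - haar_w i s)\<^sup>2) \<le> \<bar>t - s\<bar>"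
proof -
  have *: "(\<Sum>i\<in>S. (haar_w i t - haar_w i s)\<^sup>2) \<le> t - s" if st: "0 \<le> s" "s \<le> t" "t \<le> 1" for s t
  proof -
    have "(\<Sum>i\<in>S. (haar_w i t - haar_w i s)\<^sup>2) = (\<Sum>i\<in>S. (haar_transform (indicator {s<..t}) i)\<^sup>2)"
      using assms(4) haar_w_diff_eq_transform[OF st] by (intro sum.cong) auto
    also have "\<dots> \<le> (LINT x|unit_lebesgue. (indicator {s<..t} x)\<^sup>2)"
      using assms by (intro bessel_haar[of _ 1]) (auto simp: indicator_def)
    also have "\<dots> = (LINT x|unit_lebesgue. indicator {s<..t} x)"
      by (intro Bochner_Integration.integral_cong) (auto simp: indicator_def)
    also have "\<dots> = t - s"
    proof -
      have "{s<..t} \<subseteq> {0..1}" using st by auto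
      then have "measure unit_lebesgue ({s<..t} \<inter> {0..1}) = measure lborel {s<..t}"
        by (simp add: measure_restrict_space Int_absorb2)
      then show ?thesis using st by (simp add: measure_def)
    qed
    finally show ?thesis .
  qed
  show ?thesis
    using *[of s t] *[of t s] assms(1,2) by (cases "s \<le> t") (auto simp: power2_commute)
qed

lemma sum_haar_w_power2_le:
  assumes "t \<in> {0..1}" "finite S" "S \<subseteq> {1..}"
  shows "(\<Sum>i\<in>S. (haar_w i t)\<^sup>2) \<le> 1"
proof -
  have "(\<Sum>i\<in>S. (haar_w i t)\<^sup>2) = (\<Sum>i\<in>S. (haar_transform (indicator {0..t}) i)\<^sup>2)"
    using haar_w_eq_transform[OF assms(1)] by simp
  also have "\<dots> \<le> (LINT x|unit_lebesgue. (indicator {0..t} x)\<^sup>2)"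
    using assms by (intro bessel_haar[of _ 1]) (auto simp: indicator_def)
  also have "\<dots> \<le> (LINT x|unit_lebesgue. 1)"
    by (intro integral_mono integrable_unit_bounded[of _ 1]) (auto simp: indicator_def)
  also have "\<dots> = 1" by (simp add: measure_restrict_space)
  finally show ?thesis .
qed

text \<open>Cauchy-Schwarz on a finite set, with the partial norm of \<open>c\<close> replaced by
  the full one.\<close>

lemma ell2_sum_abs_mult_le:
  assumes "c \<in> ell2" "finite S" "S \<subseteq> {1..}" "(\<Sum>i\<in>S. (u i)\<^sup>2) \<le> K"
  shows "(\<Sum>i\<in>S. \<bar>c i * u i\<bar>) \<le> ell2_norm c * sqrt K"
proof -
  have "(\<Sum>i\<in>S. (c i)\<^sup>2) \<le> (\<Sum>\<^sub>\<infinity>i\<in>{1..}. (c i)\<^sup>2)"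
    using assms(1-3) by (intro finite_sum_le_infsum) (auto simp: ell2_def)
  then have "L2_set c S \<le> ell2_norm c" by (simp add: L2_set_def ell2_norm_def)
  moreover have "L2_set u S \<le> sqrt K" using assms(4) by (simp add: L2_set_def)
  ultimately have "L2_set c S * L2_set u S \<le> ell2_norm c * sqrt K"
    by (intro mult_mono) (auto simp: ell2_norm_def infsum_nonneg)
  with L2_set_mult_ineq[of c u S] show ?thesis by (simp add: abs_mult)
qed

lemma ell2_norm_nonneg: "0 \<le> ell2_norm c"
  by (simp add: ell2_norm_def infsum_nonneg)

text \<open>Measurability comes from continuity. This serves the single functions
  \<open>haar_w i\<close> as well as their infinite combinations.\<close>

lemma measurable_if_Holder_half:
  fixes f :: "real \<Rightarrow> real"
  assumes "\<And>s t. s \<in> {0..1} \<Longrightarrow> t \<in> {0..1} \<Longrightarrow> \<bar>f t - f s\<bar> \<le> K * sqrt \<bar>t - s\<bar>"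
  shows "f \<in> borel_measurable unit_lebesgue"
proof (rule continuous_imp_measurable_on_sets_lebesgue)
  show "continuous_on {0..1} f"
    unfolding continuous_on_def
  proof
    fix s :: real assume s: "s \<in> {0..1}"
    have "((\<lambda>t. K * sqrt \<bar>t - s\<bar>) \<longlongrightarrow> K * sqrt \<bar>s - s\<bar>) (at s within {0..1})"
      by (intro tendsto_intros)
    then have "((\<lambda>t. K * sqrt \<bar>t - s\<bar>) \<longlongrightarrow> 0) (at s within {0..1})" by simp
    then have "((\<lambda>t. f t - f s) \<longlongrightarrow> 0) (at s within {0..1})"
      by (rule Lim_null_comparison[rotated])
         (use assms[OF s] in \<open>auto simp: eventually_at intro!: exI[of _ 1]\<close>)
    then show "(f \<longlongrightarrow> f s) (at s within {0..1})" by (simp add: LIM_zero_iff)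
  qed
qed auto

lemma measurable_haar_w:
  assumes "1 \<le> i"
  shows "haar_w i \<in> borel_measurable unit_lebesgue"
proof (rule measurable_if_Holder_half[of _ 1])
  fix s t :: real assume "s \<in> {0..1}" "t \<in> {0..1}"
  then have "(haar_w i t - haar_w i s)\<^sup>2 \<le> \<bar>t - s\<bar>"
    using sum_haar_w_diff_power2_le[of s t "{i}"] assms by simp
  then show "\<bar>haar_w i t - haar_w i s\<bar> \<le> 1 * sqrt \<bar>t - s\<bar>"
    by (metis mult_1 real_sqrt_abs real_sqrt_le_iff)
qed

section \<open>The series in the integrated wavelets and its Haar coefficients\<close>

definition haar_prim :: "(nat \<Rightarrow> real) \<Rightarrow> real \<Rightarrow> real" where
  "haar_prim c t = (\<Sum>\<^sub>\<infinity>i\<in>{1..}. c i * haar_w i t)"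

lemma sum_abs_haar_prim_le:
  assumes "c \<in> ell2" "t \<in> {0..1}" "finite S" "S \<subseteq> {1..}"
  shows "(\<Sum>i\<in>S. \<bar>c i * haar_w i t\<bar>) \<le> ell2_norm c"
  using ell2_sum_abs_mult_le[OF assms(1,3,4) sum_haar_w_power2_le[OF assms(2-4)]] by simp

lemma haar_prim_summable:
  assumes "c \<in> ell2" "t \<in> {0..1}"
  shows "(\<lambda>i. c i * haar_w i t) summable_on {1..}"
  using sum_abs_haar_prim_le[OF assms] by (rule summable_on_if_abs_partial_sums_le)

lemma abs_haar_prim_le:
  assumes "c \<in> ell2" "t \<in> {0..1}"
  shows "\<bar>haar_prim c t\<bar> \<le> ell2_norm c"
  unfolding haar_prim_def
  using sum_abs_haar_prim_le[OF assms] by (rule summable_on_if_abs_partial_sums_le)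

lemma haar_prim_Holder:
  assumes "c \<in> ell2" "s \<in> {0..1}" "t \<in> {0..1}"
  shows "\<bar>haar_prim c t - haar_prim c s\<bar> \<le> ell2_norm c * sqrt \<bar>t - s\<bar>"
proof -
  have "((\<lambda>i. c i * haar_w i t + - (c i * haar_w i s)) has_sum (haar_prim c t + - haar_prim c s)) {1..}"
    unfolding haar_prim_def
    using assms by (intro has_sum_add has_sum_uminusI has_sum_infsum haar_prim_summable)
  then have "haar_prim c t - haar_prim c s = (\<Sum>\<^sub>\<infinity>i\<in>{1..}. c i * (haar_w i t - haar_w i s))"
    by (intro infsumI[symmetric]) (simp add: right_diff_distrib)
  also have "\<bar>\<dots>\<bar> \<le> ell2_norm c * sqrt \<bar>t - s\<bar>"
    using assms
    by (intro summable_on_if_abs_partial_sums_le(2) ell2_sum_abs_mult_le sum_haar_w_diff_power2_le) auto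
  finally show ?thesis .
qed

lemma measurable_haar_prim:
  assumes "c \<in> ell2"
  shows "haar_prim c \<in> borel_measurable unit_lebesgue"
  using haar_prim_Holder[OF assms] by (rule measurable_if_Holder_half)

text \<open>Summation and integration are interchanged; the majorant is \<open>ell2_norm c\<close>
  times a bound of the wavelet.\<close>

lemma transp_haar_P_has_sum:
  assumes "c \<in> ell2" "1 \<le> l"
  shows "((\<lambda>i. transp_inf haar_P l i * c i) has_sum haar_transform (haar_prim c) l) {1..}"
proof -
  obtain B where B: "0 \<le> B" "\<And>t. \<bar>haar l t\<bar> \<le> B" using haar_bounded[OF assms(2)] by blast
  define F where "F i t = c i * haar_w i t * haar l t" for i t
  have bd: "(\<Sum>i\<in>S. \<bar>F i t\<bar>) \<le> ell2_norm c * B" if "t \<in> space unit_lebesgue" "finite S" "S \<subseteq> {1..}" for S t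
  proof -
    have "(\<Sum>i\<in>S. \<bar>F i t\<bar>) = (\<Sum>i\<in>S. \<bar>c i * haar_w i t\<bar>) * \<bar>haar l t\<bar>"
      by (simp add: F_def abs_mult sum_distrib_right)
    also have "\<dots> \<le> ell2_norm c * B"
      using that B sum_abs_haar_prim_le[OF assms(1)] by (intro mult_mono) (auto simp: ell2_norm_nonneg)
    finally show ?thesis .
  qed
  have meas: "F i \<in> borel_measurable unit_lebesgue" if "i \<in> {1..}" for i
  proof -
    have [measurable]: "haar_w i \<in> borel_measurable unit_lebesgue"
      using that by (intro measurable_haar_w) simp
    show ?thesis unfolding F_def[abs_def] by measurable
  qed
  have inf: "infinite {1::nat..}" by (rule infinite_Ici)
  have "((\<lambda>i. integral\<^sup>L unit_lebesgue (F i)) has_sum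
      (LINT t|unit_lebesgue. (\<Sum>\<^sub>\<infinity>i\<in>{1..}. F i t))) {1..}"
    by (rule unit_lebesgue.bounded_infsum_integral(2)[OF _ inf meas bd]) auto
  moreover have "integral\<^sup>L unit_lebesgue (F i) = transp_inf haar_P l i * c i" for i
    by (simp add: F_def[abs_def] transp_inf_def haar_P_def mult_ac)
  moreover have "(\<Sum>\<^sub>\<infinity>i\<in>{1..}. F i t) = haar_prim c t * haar l t" for t
    by (simp add: F_def haar_prim_def infsum_cmult_left')
  ultimately show ?thesis by (simp add: haar_transform_def)
qed

lemma app_inf_transp_haar_P:
  assumes "c \<in> ell2"
  shows "app_inf_converges (transp_inf haar_P) c"
    and "1 \<le> l \<Longrightarrow> app_inf (transp_inf haar_P) c l = haar_transform (haar_prim c) l"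
  using transp_haar_P_has_sum[OF assms]
  by (auto simp: app_inf_converges_def app_inf_def infsumI summable_on_def)

section \<open>Decay of the coefficients and pointwise expansion\<close>

lemma powr_half_eq_sqrt: "2 powr (real j / 2) = sqrt (2 ^ j)"
  using powr_half_mult_self[of j] by (intro real_sqrt_unique[symmetric]) (simp_all add: power2_eq_square)

lemma dist_dyad_le:
  assumes "s \<in> dyad j k" "t \<in> dyad j k"
  shows "\<bar>t - s\<bar> \<le> 1 / 2 ^ j"
proof -
  have "(real k + 1) / 2 ^ j = real k / 2 ^ j + 1 / 2 ^ j" by (simp add: add_divide_distrib)
  then show ?thesis using assms unfolding dyad_def atLeastLessThan_iff by linarith
qed

lemma haar_prim_dyad_diff_le:
  assumes "c \<in> ell2" "s \<in> {0..1}" "t \<in> {0..1}" "s \<in> dyad j k" "t \<in> dyad j k"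
  shows "\<bar>haar_prim c t - haar_prim c s\<bar> \<le> ell2_norm c * sqrt (1 / 2 ^ j)"
proof -
  have "\<bar>haar_prim c t - haar_prim c s\<bar> \<le> ell2_norm c * sqrt \<bar>t - s\<bar>"
    by (rule haar_prim_Holder[OF assms(1-3)])
  also have "\<dots> \<le> ell2_norm c * sqrt (1 / 2 ^ j)"
    using dist_dyad_le[OF assms(4,5)] ell2_norm_nonneg by (intro mult_left_mono real_sqrt_le_mono)
  finally show ?thesis .
qed

lemma abs_integral_dyad_le:
  fixes g :: "real \<Rightarrow> real"
  assumes g: "integrable unit_lebesgue g" and k: "k < 2 ^ j"
    and le: "\<And>t. t \<in> {0..1} \<Longrightarrow> \<bar>g t\<bar> \<le> K * indicator (dyad j k) t"
  shows "\<bar>integral\<^sup>L unit_lebesgue g\<bar> \<le> K / 2 ^ j"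
proof -
  have "\<bar>integral\<^sup>L unit_lebesgue g\<bar> \<le> (LINT t|unit_lebesgue. \<bar>g t\<bar>)"
    using integral_norm_bound[of unit_lebesgue g] by simp
  also have "\<dots> \<le> (LINT t|unit_lebesgue. K * indicator (dyad j k) t)"
    using g le integrable_indicator_dyad by (intro integral_mono) auto
  also have "\<dots> = K / 2 ^ j" using measure_dyad[OF k] by simp
  finally show ?thesis .
qed

lemma haar_coeff_1_le:
  assumes "c \<in> ell2"
  shows "\<bar>haar_transform (haar_prim c) 1\<bar> \<le> ell2_norm c"
proof -
  have "\<bar>haar_transform (haar_prim c) 1\<bar> \<le> ell2_norm c / 2 ^ 0"
    unfolding haar_transform_def
  proof (rule abs_integral_dyad_le[where k = 0])
    show "integrable unit_lebesgue (\<lambda>t. haar_prim c t * haar 1 t)"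
      using measurable_haar_prim[OF assms] abs_haar_prim_le[OF assms]
      by (rule integrable_mult_haar) simp_all
    show "\<bar>haar_prim c t * haar 1 t\<bar> \<le> ell2_norm c * indicator (dyad 0 0) t" if "t \<in> {0..1}" for t
      using abs_haar_prim_le[OF assms that] by (simp add: haar_1[simplified] indicator_def)
  qed simp
  then show ?thesis by simp
qed

text \<open>The wavelet has mean zero, so the value at the left end \<open>s\<close> of its support
  may be subtracted. By Hoelder continuity the difference is at most \<open>ell2_norm c\<close>
  times the square root of \<open>1 / 2 ^ j\<close>; the height of the wavelet cancels that root,
  and the length of the support gives the decay.\<close>

lemma haar_coeff_Suc_le:
  assumes "c \<in> ell2" and k: "k < 2 ^ j"
  shows "\<bar>haar_transform (haar_prim c) (2 ^ j + k + 1)\<bar> \<le> ell2_norm c / 2 ^ j"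
proof -
  define l where "l = 2 ^ j + k + 1"
  have l: "1 \<le> l" by (simp add: l_def)
  define s where "s = real k / 2 ^ j"
  have "real k < 2 ^ j" using k by (metis of_nat_less_iff of_nat_numeral of_nat_power)
  then have s: "s \<in> {0..1}" "s \<in> dyad j k"
    by (auto simp: s_def dyad_def divide_strict_right_mono)
  have int: "integrable unit_lebesgue (\<lambda>t. haar_prim c t * haar l t)"
    using measurable_haar_prim[OF assms(1)] abs_haar_prim_le[OF assms(1)] l
    by (rule integrable_mult_haar)
  have "haar_transform (haar_prim c) l = (LINT t|unit_lebesgue. (haar_prim c t - haar_prim c s) * haar l t)"
    using int integrable_haar[OF l] integral_haar_Suc[OF k]
    by (simp add: haar_transform_def left_diff_distrib l_def)
  also have "\<bar>\<dots>\<bar> \<le> ell2_norm c / 2 ^ j"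
  proof (rule abs_integral_dyad_le[OF _ k])
    show "integrable unit_lebesgue (\<lambda>t. (haar_prim c t - haar_prim c s) * haar l t)"
      using int integrable_haar[OF l] by (simp add: left_diff_distrib)
    show "\<bar>(haar_prim c t - haar_prim c s) * haar l t\<bar> \<le> ell2_norm c * indicator (dyad j k) t"
      if t: "t \<in> {0..1}" for t
    proof (cases "t \<in> dyad j k")
      case True
      have "\<bar>(haar_prim c t - haar_prim c s) * haar l t\<bar> = \<bar>haar_prim c t - haar_prim c s\<bar> * sqrt (2 ^ j)"
        using True unfolding abs_mult l_def abs_haar[OF k] powr_half_eq_sqrt by simp
      also have "\<dots> \<le> ell2_norm c * sqrt (1 / 2 ^ j) * sqrt (2 ^ j)"
        using haar_prim_dyad_diff_le[OF assms(1) s(1) t s(2) True] by (intro mult_right_mono) auto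
      also have "\<dots> = ell2_norm c * indicator (dyad j k) t"
        using True by (simp add: real_sqrt_divide)
      finally show ?thesis .
    next
      case False
      then show ?thesis using haar_eq_0[OF k False] by (simp add: l_def)
    qed
  qed
  finally show ?thesis by (simp only: l_def)
qed

section \<open>Absolute convergence of Haar expansions and identification of the sum\<close>

lemma haar_at_1: "1 \<le> i \<Longrightarrow> haar i 1 = 0"
proof (erule haar_index_cases)
  fix j k :: nat assume k: "k < 2 ^ j" "i = 2 ^ j + k + 1"
  have "\<lfloor>2 ^ j * (1::real)\<rfloor> = 2 ^ j" by simp
  moreover have "int k < 2 ^ j" using k(1) by simp
  ultimately have "1 \<notin> dyad j k" unfolding mem_dyad_iff by linarith
  then show ?thesis using haar_eq_0[OF k(1)] k(2) by simp
qed (simp add: haar_def)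

text \<open>Uniform absolute convergence of the expansion, phrased by finite subsets to match the
  hypotheses of the interchange and double-sum lemmas. It is the property of \<open>a\<close> and
  \<open>b\<close> on which the bilinear forms rest.\<close>

definition haar_abs_bounded :: "(nat \<Rightarrow> real) \<Rightarrow> real \<Rightarrow> bool" where
  "haar_abs_bounded a K \<longleftrightarrow>
     (\<forall>t\<in>{0..1}. \<forall>S. finite S \<longrightarrow> S \<subseteq> {1..} \<longrightarrow> (\<Sum>i\<in>S. \<bar>a i * haar i t\<bar>) \<le> K)"

text \<open>At a given point level \<open>j\<close> has one nonzero term, at most M times the
  \<open>j\<close>-th power of \<open>1 / sqrt 2\<close>, because the height is the square root of
  \<open>2 ^ j\<close>. The bound is the geometric series plus \<open>M\<close> for the scaling
  function.\<close>

lemma haar_abs_boundedI: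
  assumes a1: "\<bar>a 1\<bar> \<le> M"
    and a: "\<And>j k. k < 2 ^ j \<Longrightarrow> \<bar>a (2 ^ j + k + 1)\<bar> \<le> M / 2 ^ j"
  shows "haar_abs_bounded a (M + M * (1 / (1 - 1 / sqrt 2)))"
  unfolding haar_abs_bounded_def
proof (intro ballI allI impI)
  fix t :: real and S :: "nat set"
  assume t: "t \<in> {0..1}" and S: "finite S" "S \<subseteq> {1..}"
  define r :: real where "r = 1 / sqrt 2"
  have M: "0 \<le> M" using a1 by linarith
  have r: "0 \<le> r" "r < 1" by (simp_all add: r_def)
  then have sm: "summable (\<lambda>j. r ^ j)" by (intro summable_geometric) simp
  have geo: "(\<Sum>j<J. r ^ j) \<le> 1 / (1 - r)" for J
    using sum_le_suminf[OF sm, of "{..<J}"] r suminf_geometric[of r] by simp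
  have term_le: "\<bar>a (2 ^ j + k + 1) * haar (2 ^ j + k + 1) t\<bar> \<le> M * r ^ j" if k: "k < 2 ^ j" for j k
  proof -
    have "\<bar>a (2 ^ j + k + 1) * haar (2 ^ j + k + 1) t\<bar> \<le> M / 2 ^ j * sqrt (2 ^ j)"
      unfolding abs_mult abs_haar[OF k] powr_half_eq_sqrt
      using a[OF k] M by (intro mult_mono) (auto simp: indicator_def)
    also have "\<dots> = M * r ^ j"
      using real_sqrt_mult_self[of "2 ^ j"]
      by (simp add: r_def power_one_over real_sqrt_power[symmetric] field_simps)
    finally show ?thesis .
  qed
  have level: "(\<Sum>i\<in>{1..2 ^ J}. \<bar>a i * haar i t\<bar>) \<le> M + M * (\<Sum>j<J. r ^ j)" if t1: "t \<in> {0..<1}" for J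
  proof (induction J)
    case 0
    show ?case using t1 a1 by (simp add: haar_def)
  next
    case (Suc J)
    note K = sum_level_haar[OF t1, of J]
    have "(\<Sum>k<2 ^ J. \<bar>a (2 ^ J + k + 1) * haar (2 ^ J + k + 1) t\<bar>) \<le> M * r ^ J"
      by (subst K(3)) (use haar_eq_0 in simp, use term_le[OF K(1)] in simp)
    then have "(\<Sum>i\<in>{1..2 ^ Suc J}. \<bar>a i * haar i t\<bar>) \<le> M + M * (\<Sum>j<J. r ^ j) + M * r ^ J"
      using Suc.IH unfolding sum_upto_level_Suc by linarith
    then show ?case by (simp add: distrib_left)
  qed
  have "(\<Sum>i\<in>S. \<bar>a i * haar i t\<bar>) \<le> M + M * (1 / (1 - r))"
  \<comment> \<open>The collapse of a level to one term holds only on [0, 1); at 1 every wavelet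
    vanishes.\<close>
  proof (cases "t = 1")
    case True
    have "(\<Sum>i\<in>S. \<bar>a i * haar i t\<bar>) = 0"
      using S(2) haar_at_1 True by (intro sum.neutral) auto
    then show ?thesis using M r by simp
  next
    case False
    then have t1: "t \<in> {0..<1}" using t by auto
    obtain J where "S \<subseteq> {..J}" using S(1) by (auto simp: finite_nat_set_iff_bounded_le)
    then have "S \<subseteq> {1..J}" using S(2) by auto
    also have "\<dots> \<subseteq> {1..2 ^ J}" using less_exp[of J] by simp
    finally have "S \<subseteq> {1..2 ^ J}" .
    then have "(\<Sum>i\<in>S. \<bar>a i * haar i t\<bar>) \<le> (\<Sum>i\<in>{1..2 ^ J}. \<bar>a i * haar i t\<bar>)"
      by (intro sum_mono2) auto
    also note level[OF t1, of J]
    also have "M + M * (\<Sum>j<J. r ^ j) \<le> M + M * (1 / (1 - r))"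
      using geo M by (intro add_left_mono mult_left_mono)
    finally show ?thesis .
  qed
  then show "(\<Sum>i\<in>S. \<bar>a i * haar i t\<bar>) \<le> M + M * (1 / (1 - 1 / sqrt 2))"
    by (simp add: r_def)
qed

lemma haar_expansion_summable:
  assumes "haar_abs_bounded a K" "t \<in> {0..1}"
  shows "(\<lambda>i. a i * haar i t) summable_on {1..}"
  using assms unfolding haar_abs_bounded_def by (intro summable_on_if_abs_partial_sums_le) auto

text \<open>By \<open>haar_kernel\<close>, the partial sum over complete levels is the mean of
  \<open>f\<close> over the interval of level \<open>J\<close> that contains
  \<open>t\<close>.\<close>

lemma haar_partial_sum_eq:
  assumes f: "f \<in> borel_measurable unit_lebesgue" "\<And>t. t \<in> {0..1} \<Longrightarrow> \<bar>f t\<bar> \<le> K"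
    and t: "t \<in> {0..<1}"
  shows "(\<Sum>i\<in>{1..2 ^ J}. haar_transform f i * haar i t) =
    (LINT s|unit_lebesgue. f s * (2 ^ J * indicator (dyad J (nat \<lfloor>2 ^ J * t\<rfloor>)) s))"
proof -
  define k where "k = nat \<lfloor>2 ^ J * t\<rfloor>"
  note k = sum_level_haar(1,2)[OF t, of J, folded k_def]
  have int: "integrable unit_lebesgue (\<lambda>s. f s * haar i s * haar i t)" if "i \<in> {1..2 ^ J}" for i
    using integrable_mult_haar[OF f, of i] that by auto
  have "(\<Sum>i\<in>{1..2 ^ J}. haar_transform f i * haar i t) =
      (\<Sum>i\<in>{1..2 ^ J}. LINT s|unit_lebesgue. f s * haar i s * haar i t)"
    by (simp add: haar_transform_def)
  also have "\<dots> = (LINT s|unit_lebesgue. (\<Sum>i\<in>{1..2 ^ J}. f s * haar i s * haar i t))"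
    using int by (simp add: Bochner_Integration.integral_sum)
  also have "\<dots> = (LINT s|unit_lebesgue. f s * (2 ^ J * indicator (dyad J k) s))"
  proof (rule Bochner_Integration.integral_cong)
    fix s assume "s \<in> space unit_lebesgue"
    then have s: "s \<in> {0..1}" by simp
    have "(\<Sum>i\<in>{1..2 ^ J}. haar i s * haar i t) = 2 ^ J * indicator (dyad J k) s"
    \<comment> \<open>The kernel identity covers only [0, 1); at \<open>s = 1\<close> both sides are
      zero.\<close>
    proof (cases "s = 1")
      case True
      have "int k < 2 ^ J" using k(1) by simp
      then have "1 \<notin> dyad J k" by (simp add: mem_dyad_iff)
      moreover have "(\<Sum>i\<in>{1..2 ^ J}. haar i s * haar i t) = 0"
        using haar_at_1 True by (intro sum.neutral) auto
      ultimately show ?thesis using True by simp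
    next
      case False
      then have "s \<in> {0..<1}" using s by auto
      from haar_kernel[OF this t, of J] k(2) show ?thesis
        by (simp add: indicator_def mem_dyad_iff)
    qed
    then show "(\<Sum>i\<in>{1..2 ^ J}. f s * haar i s * haar i t) = f s * (2 ^ J * indicator (dyad J k) s)"
      by (simp add: mult.assoc flip: sum_distrib_left)
  qed simp
  finally show ?thesis by (simp only: k_def)
qed

text \<open>The error is the mean of the differences of \<open>haar_prim c\<close> over an interval
  of length \<open>1 / 2 ^ J\<close>, and Hoelder continuity bounds each of them.\<close>

lemma haar_partial_sum_prim_error:
  assumes "c \<in> ell2" and t: "t \<in> {0..<1}"
  shows "\<bar>(\<Sum>i\<in>{1..2 ^ J}. haar_transform (haar_prim c) i * haar i t) - haar_prim c t\<bar>
    \<le> ell2_norm c * sqrt (1 / 2 ^ J)"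
proof -
  define k where "k = nat \<lfloor>2 ^ J * t\<rfloor>"
  note k = sum_level_haar(1,2)[OF t, of J, folded k_def]
  define D where "D = (indicator (dyad J k) :: real \<Rightarrow> real)"
  note f = measurable_haar_prim[OF assms(1)] abs_haar_prim_le[OF assms(1)]
  have [measurable]: "haar_prim c \<in> borel_measurable unit_lebesgue" by (rule f(1))
  have intD: "integrable unit_lebesgue D" unfolding D_def by (rule integrable_indicator_dyad)
  have D_le: "\<bar>D s\<bar> \<le> 1" for s by (simp add: D_def indicator_def)
  have int: "integrable unit_lebesgue (\<lambda>s. haar_prim c s * (2 ^ J * D s))"
    by (rule integrable_unit_bounded[of _ "ell2_norm c * 2 ^ J"])
       (use f(2) ell2_norm_nonneg in \<open>auto simp: D_def abs_mult indicator_def\<close>)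
  \<comment> \<open>The normalised indicator has integral 1, so the constant
    \<open>haar_prim c t\<close> can be written as an integral against it.\<close>
  have "(LINT s|unit_lebesgue. 2 ^ J * D s) = 1"
    using measure_dyad[OF k(1)] by (simp add: D_def)
  then have "(\<Sum>i\<in>{1..2 ^ J}. haar_transform (haar_prim c) i * haar i t) - haar_prim c t =
      (LINT s|unit_lebesgue. haar_prim c s * (2 ^ J * D s)) - (LINT s|unit_lebesgue. haar_prim c t * (2 ^ J * D s))"
    using haar_partial_sum_eq[OF f t, of J] by (simp add: D_def k_def)
  also have "\<dots> = (LINT s|unit_lebesgue. haar_prim c s * (2 ^ J * D s) - haar_prim c t * (2 ^ J * D s))"
    using int intD by (intro Bochner_Integration.integral_diff[symmetric]) auto
  also have "\<bar>\<dots>\<bar> \<le> (ell2_norm c * sqrt (1 / 2 ^ J) * 2 ^ J) / 2 ^ J"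
  proof (rule abs_integral_dyad_le[OF _ k(1)])
    show "integrable unit_lebesgue (\<lambda>s. haar_prim c s * (2 ^ J * D s) - haar_prim c t * (2 ^ J * D s))"
      using int intD by auto
    fix s :: real assume s: "s \<in> {0..1}"
    show "\<bar>haar_prim c s * (2 ^ J * D s) - haar_prim c t * (2 ^ J * D s)\<bar>
        \<le> ell2_norm c * sqrt (1 / 2 ^ J) * 2 ^ J * indicator (dyad J k) s"
    proof (cases "s \<in> dyad J k")
      case True
      have "t \<in> {0..1}" using t by auto
      from haar_prim_dyad_diff_le[OF assms(1) this s k(2) True] True show ?thesis
        by (simp add: D_def abs_mult flip: left_diff_distrib)
    qed (simp add: D_def)
  qed
  finally show ?thesis by simp
qed

text \<open>These sets eventually contain every finite set of indices. An unordered sum can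
  therefore be computed along complete levels, where the partial sums are means over
  intervals.\<close>

lemma filterlim_atLeastAtMost_pow2:
  "filterlim (\<lambda>J. {1..2 ^ J}) (finite_subsets_at_top {1::nat..}) sequentially"
  unfolding filterlim_finite_subsets_at_top
proof (intro allI impI)
  fix X :: "nat set" assume X: "finite X \<and> X \<subseteq> {1..}"
  then obtain n where n: "X \<subseteq> {..n}" by (auto simp: finite_nat_set_iff_bounded_le)
  have "X \<subseteq> {1..2 ^ J}" if "n \<le> J" for J
  proof
    fix x assume "x \<in> X"
    then have "1 \<le> x" "x \<le> J" using X n that by auto
    moreover have "J \<le> (2::nat) ^ J" using less_exp[of J] by simp
    ultimately show "x \<in> {1..2 ^ J}" by (meson atLeastAtMost_iff order.trans)
  qed
  then show "\<forall>\<^sub>F J in sequentially. finite {1::nat..2 ^ J} \<and> X \<subseteq> {1..2 ^ J} \<and> {1..2 ^ J} \<subseteq> {1::nat..}"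
    by (auto intro!: eventually_sequentiallyI[of n])
qed

lemma haar_expansion_prim:
  assumes c: "c \<in> ell2" and t: "t \<in> {0..<1}"
    and summ: "(\<lambda>i. haar_transform (haar_prim c) i * haar i t) summable_on {1..}"
  shows "(\<Sum>\<^sub>\<infinity>i\<in>{1..}. haar_transform (haar_prim c) i * haar i t) = haar_prim c t"
proof -
  define p where "p J = (\<Sum>i\<in>{1..2 ^ J}. haar_transform (haar_prim c) i * haar i t)" for J
  have "p \<longlonglongrightarrow> (\<Sum>\<^sub>\<infinity>i\<in>{1..}. haar_transform (haar_prim c) i * haar i t)"
    unfolding p_def
    using has_sum_infsum[OF summ] unfolding has_sum_def
    by (rule filterlim_compose[OF _ filterlim_atLeastAtMost_pow2])
  moreover have "p \<longlonglongrightarrow> haar_prim c t"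
  proof (rule LIM_zero_cancel, rule Lim_null_comparison)
    show "\<forall>\<^sub>F J in sequentially. norm (p J - haar_prim c t) \<le> ell2_norm c * sqrt (1 / 2 ^ J)"
      using haar_partial_sum_prim_error[OF c t] by (simp add: p_def)
    have "(\<lambda>J. (1 / 2) ^ J :: real) \<longlonglongrightarrow> 0" by (rule LIMSEQ_realpow_zero) simp_all
    then have "(\<lambda>J. ell2_norm c * sqrt ((1 / 2) ^ J)) \<longlonglongrightarrow> ell2_norm c * sqrt 0"
      by (intro tendsto_mult tendsto_const tendsto_real_sqrt)
    then show "(\<lambda>J. ell2_norm c * sqrt (1 / 2 ^ J)) \<longlonglongrightarrow> 0" by (simp add: power_one_over)
  qed
  ultimately show ?thesis by (rule LIMSEQ_unique)
qed

section \<open>Bilinear forms in Haar wavelets\<close>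

text \<open>A finite set of pairs is enlarged to the product of its projections, over which the
  majorising double sum factors.\<close>

lemma sum_abs_pairs_le:
  fixes x y :: "nat \<Rightarrow> real"
  assumes x: "\<And>S. finite S \<Longrightarrow> S \<subseteq> A \<Longrightarrow> (\<Sum>i\<in>S. \<bar>x i\<bar>) \<le> K"
    and y: "\<And>S. finite S \<Longrightarrow> S \<subseteq> B \<Longrightarrow> (\<Sum>l\<in>S. \<bar>y l\<bar>) \<le> L"
    and g: "\<And>i l. i \<in> A \<Longrightarrow> l \<in> B \<Longrightarrow> \<bar>g (i, l)\<bar> \<le> \<bar>x i\<bar> * \<bar>y l\<bar>"
    and S: "finite S" "S \<subseteq> A \<times> B"
  shows "(\<Sum>p\<in>S. \<bar>g p\<bar>) \<le> K * (L :: real)"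
proof -
  have fin: "finite (fst ` S)" "finite (snd ` S)" using S(1) by auto
  have sub: "fst ` S \<subseteq> A" "snd ` S \<subseteq> B" using S(2) by auto
  have K: "0 \<le> K" using x[of "{}"] by simp
  have "(\<Sum>p\<in>S. \<bar>g p\<bar>) \<le> (\<Sum>p\<in>fst ` S \<times> snd ` S. \<bar>g p\<bar>)"
    using fin by (intro sum_mono2 subset_fst_snd) auto
  also have "\<dots> \<le> (\<Sum>p\<in>fst ` S \<times> snd ` S. \<bar>x (fst p)\<bar> * \<bar>y (snd p)\<bar>)"
  proof (rule sum_mono)
    fix p assume "p \<in> fst ` S \<times> snd ` S"
    then have "fst p \<in> A" "snd p \<in> B" using sub by (auto simp: mem_Times_iff subset_iff)
    from g[OF this] show "\<bar>g p\<bar> \<le> \<bar>x (fst p)\<bar> * \<bar>y (snd p)\<bar>" by simp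
  qed
  also have "\<dots> = (\<Sum>i\<in>fst ` S. \<bar>x i\<bar>) * (\<Sum>l\<in>snd ` S. \<bar>y l\<bar>)"
    by (simp add: sum_product sum.cartesian_product case_prod_unfold)
  also have "\<dots> \<le> K * L"
    using K by (intro mult_mono x y fin sub) (auto intro: sum_nonneg)
  finally show ?thesis .
qed

lemma infsum_product_pairs:
  fixes x y :: "nat \<Rightarrow> real"
  assumes "(\<lambda>(i, l). x i * y l) summable_on A \<times> B"
  shows "(\<Sum>\<^sub>\<infinity>(i, l)\<in>A \<times> B. x i * y l) = infsum x A * infsum y B"
  using infsum_Sigma_banach[OF assms] by (simp add: infsum_cmult_left' infsum_cmult_right')

text \<open>Together with its counterpart for convergence, this reduces each claim about the
  transposed matrix to the original one with \<open>a\<close> and \<open>b\<close>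
  exchanged.\<close>

lemma bil_transp_inf: "bil a (transp_inf N) b = bil b N a"
proof -
  have "bil a (transp_inf N) b = (\<Sum>\<^sub>\<infinity>(l, i)\<in>{1..} \<times> {1..}. a i * transp_inf N i l * b l)"
    unfolding bil_def
    by (rule infsum_reindex_bij_betw[of prod.swap, symmetric, THEN trans])
       (auto simp: bij_betw_def inj_on_def case_prod_unfold)
  then show ?thesis by (simp add: bil_def transp_inf_def mult_ac)
qed

lemma bil_converges_transp_inf: "bil_converges a (transp_inf N) b \<longleftrightarrow> bil_converges b N a"
proof -
  have "bil_converges a (transp_inf N) b \<longleftrightarrow>
      (\<lambda>(l, i). a i * transp_inf N i l * b l) summable_on {1..} \<times> {1..}"
    unfolding bil_converges_def
    by (rule summable_on_reindex_bij_betw[of prod.swap, symmetric, THEN trans])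
       (auto simp: bij_betw_def inj_on_def case_prod_unfold)
  then show ?thesis by (simp add: bil_converges_def transp_inf_def mult_ac)
qed

lemma bil_linear_left:
  assumes "bil_converges c N d" "bil_converges c' N d"
  shows "bil (\<lambda>i. r * c i + s * c' i) N d = r * bil c N d + s * bil c' N d"
proof -
  have "((\<lambda>p. r * (case p of (i, l) \<Rightarrow> c i * N i l * d l) + s * (case p of (i, l) \<Rightarrow> c' i * N i l * d l))
      has_sum (r * bil c N d + s * bil c' N d)) ({1..} \<times> {1..})"
    using assms unfolding bil_def bil_converges_def
    by (intro has_sum_add has_sum_cmult_right has_sum_infsum)
  then show ?thesis
    unfolding bil_def by (intro infsumI) (simp add: case_prod_unfold algebra_simps)
qed

lemma bil_linear_right:
  assumes "bil_converges c N d" "bil_converges c N d'"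
  shows "bil c N (\<lambda>i. r * d i + s * d' i) = r * bil c N d + s * bil c N d'"
  using bil_linear_left[of d "transp_inf N" c d' r s] assms
  by (simp add: bil_transp_inf bil_converges_transp_inf)

section \<open>The form W: factorisation, pointwise bound and bilinearity\<close>

lemma haar_W_bil:
  assumes "c \<in> ell2" "d \<in> ell2" "t \<in> {0..1}"
  shows "bil_converges c (\<lambda>i l. haar_w i t * haar_w l t) d"
    and "haar_W c d t = haar_prim c t * haar_prim d t"
proof -
  have "(\<lambda>(i, l). c i * haar_w i t * (d l * haar_w l t)) summable_on {1..} \<times> {1..}"
    by (rule summable_on_if_abs_partial_sums_le(1), rule sum_abs_pairs_le
        [OF sum_abs_haar_prim_le[OF assms(1,3)] sum_abs_haar_prim_le[OF assms(2,3)]])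
       (auto simp: abs_mult)
  moreover have "(\<lambda>(i, l). c i * haar_w i t * (d l * haar_w l t)) =
      (\<lambda>(i, l). c i * (haar_w i t * haar_w l t) * d l)"
    by (simp add: mult_ac)
  ultimately show "bil_converges c (\<lambda>i l. haar_w i t * haar_w l t) d"
    and "haar_W c d t = haar_prim c t * haar_prim d t"
    using infsum_product_pairs[of "\<lambda>i. c i * haar_w i t" "\<lambda>i. d i * haar_w i t" "{1..}" "{1..}"]
    by (simp_all add: bil_converges_def haar_W_def bil_def haar_prim_def)
qed

lemma abs_haar_W_le:
  assumes "c \<in> ell2" "d \<in> ell2" "t \<in> {0..1}"
  shows "\<bar>haar_W c d t\<bar> \<le> ell2_norm c * ell2_norm d"
  using abs_haar_prim_le[OF assms(1,3)] abs_haar_prim_le[OF assms(2,3)] ell2_norm_nonneg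
  by (simp add: haar_W_bil[OF assms] abs_mult mult_mono)

lemma measurable_haar_W:
  assumes "c \<in> ell2" "d \<in> ell2"
  shows "haar_W c d \<in> borel_measurable unit_lebesgue"
proof -
  have "(\<lambda>t. haar_prim c t * haar_prim d t) \<in> borel_measurable unit_lebesgue"
    using assms by (intro borel_measurable_times measurable_haar_prim)
  then show ?thesis
    using haar_W_bil(2)[OF assms] by (subst measurable_cong) auto
qed

lemma bilinear_haar_W: "bilinear_ell2_L2 haar_W"
  unfolding bilinear_ell2_L2_def
proof (intro conjI ballI allI)
  fix c d assume cd: "c \<in> ell2" "d \<in> ell2"
  show "haar_W c d \<in> L2_01"
    using measurable_haar_W[OF cd] abs_haar_W_le[OF cd] by (rule bounded_in_L2_01(1))
next
  fix c c' d and r s :: real assume "c \<in> ell2" "c' \<in> ell2" "d \<in> ell2"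
  then show "AE t in unit_lebesgue. haar_W (\<lambda>i. r * c i + s * c' i) d t = r * haar_W c d t + s * haar_W c' d t"
    unfolding haar_W_def by (intro AE_I2 bil_linear_left haar_W_bil(1)) auto
next
  fix c d d' and r s :: real assume "c \<in> ell2" "d \<in> ell2" "d' \<in> ell2"
  then show "AE t in unit_lebesgue. haar_W c (\<lambda>i. r * d i + s * d' i) t = r * haar_W c d t + s * haar_W c d' t"
    unfolding haar_W_def by (intro AE_I2 bil_linear_right haar_W_bil(1)) auto
qed

text \<open>Covers \<open>\<Omega>(t)\<close> and \<open>\<Theta>(t)\<close> at once: both are entrywise dominated by the matrix of
  products \<open>\<psi>\<^sub>i(t) \<psi>\<^sub>l(t)\<close>.\<close>

lemma bil_dominated_by_haar:
  assumes a: "haar_abs_bounded a K" and b: "haar_abs_bounded b L"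
    and dom: "\<And>i l t. 1 \<le> i \<Longrightarrow> 1 \<le> l \<Longrightarrow> \<bar>N t i l\<bar> \<le> \<bar>haar i t\<bar> * \<bar>haar l t\<bar>"
    and meas: "\<And>i l. 1 \<le> i \<Longrightarrow> 1 \<le> l \<Longrightarrow> (\<lambda>t. N t i l) \<in> borel_measurable unit_lebesgue"
  shows "t \<in> {0..1} \<Longrightarrow> bil_converges a (N t) b"
    and "t \<in> {0..1} \<Longrightarrow> \<bar>bil a (N t) b\<bar> \<le> K * L"
    and "(\<lambda>t. bil a (N t) b) \<in> borel_measurable unit_lebesgue"
    and "1 \<le> n \<Longrightarrow> ((\<lambda>(i, l). a i * b l * (LINT t|unit_lebesgue. N t i l * haar n t)) has_sum
      haar_transform (\<lambda>t. bil a (N t) b) n) ({1..} \<times> {1..})"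
proof -
  define F where "F t p = (case p of (i, l) \<Rightarrow> a i * N t i l * b l)" for t p
  have bd: "(\<Sum>p\<in>S. \<bar>F t p\<bar>) \<le> K * L"
    if "t \<in> {0..1}" "finite S" "S \<subseteq> {1..} \<times> {1..}" for t S
  proof (rule sum_abs_pairs_le[OF _ _ _ that(2,3)])
    show "(\<Sum>i\<in>S. \<bar>a i * haar i t\<bar>) \<le> K" if "finite S" "S \<subseteq> {1..}" for S
      using a that \<open>t \<in> {0..1}\<close> by (simp add: haar_abs_bounded_def)
    show "(\<Sum>i\<in>S. \<bar>b i * haar i t\<bar>) \<le> L" if "finite S" "S \<subseteq> {1..}" for S
      using b that \<open>t \<in> {0..1}\<close> by (simp add: haar_abs_bounded_def)
    fix i l :: nat assume il: "i \<in> {1..}" "l \<in> {1..}"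
    have "\<bar>F t (i, l)\<bar> = \<bar>a i\<bar> * \<bar>b l\<bar> * \<bar>N t i l\<bar>" by (simp add: F_def abs_mult)
    also have "\<dots> \<le> \<bar>a i\<bar> * \<bar>b l\<bar> * (\<bar>haar i t\<bar> * \<bar>haar l t\<bar>)"
      using il by (intro mult_left_mono dom) auto
    finally show "\<bar>F t (i, l)\<bar> \<le> \<bar>a i * haar i t\<bar> * \<bar>b l * haar l t\<bar>" by (simp add: abs_mult mult_ac)
  qed
  have F_eq: "(\<lambda>(i, l). a i * N t i l * b l) = F t" for t
    by (simp add: F_def fun_eq_iff)
  have bil_F: "bil a (N t) b = infsum (F t) ({1..} \<times> {1..})" for t
    unfolding bil_def F_eq ..
  show "bil_converges a (N t) b" if "t \<in> {0..1}"
    unfolding bil_converges_def F_eq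
    using bd[OF that] by (rule summable_on_if_abs_partial_sums_le)
  show "\<bar>bil a (N t) b\<bar> \<le> K * L" if "t \<in> {0..1}"
    unfolding bil_F using bd[OF that] by (rule summable_on_if_abs_partial_sums_le)
  have inf: "infinite ({1::nat..} \<times> {1::nat..})"
    by (simp add: finite_cartesian_product_iff infinite_Ici)
  have measF: "(\<lambda>t. F t p) \<in> borel_measurable unit_lebesgue" if p: "p \<in> {1..} \<times> {1..}" for p
  proof -
    obtain i l where il: "p = (i, l)" "1 \<le> i" "1 \<le> l" using p by auto
    then have [measurable]: "(\<lambda>t. N t i l) \<in> borel_measurable unit_lebesgue" by (intro meas)
    show ?thesis unfolding F_def il(1) prod.case by measurable
  qed
  show "(\<lambda>t. bil a (N t) b) \<in> borel_measurable unit_lebesgue"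
    unfolding bil_F using bd
    by (intro unit_lebesgue.bounded_infsum_integral(1)[OF _ inf measF]) auto
  assume n: "1 \<le> n"
  obtain B where B: "0 \<le> B" "\<And>t. \<bar>haar n t\<bar> \<le> B" using haar_bounded[OF n] by blast
  \<comment> \<open>The empty sum yields the sign needed for the majorant
    \<open>K * L * B\<close>.\<close>
  have KL: "0 \<le> K * L" using bd[of 0 "{}"] by simp
  have "((\<lambda>p. LINT t|unit_lebesgue. F t p * haar n t) has_sum
      (LINT t|unit_lebesgue. (\<Sum>\<^sub>\<infinity>p\<in>{1..} \<times> {1..}. F t p * haar n t))) ({1..} \<times> {1..})"
  proof (rule unit_lebesgue.bounded_infsum_integral(2)[OF _ inf, where K = "K * L * B"])
    show "(\<lambda>t. F t p * haar n t) \<in> borel_measurable unit_lebesgue" if "p \<in> {1..} \<times> {1..}" for p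
      using measF[OF that] by (rule borel_measurable_times[OF _ measurable_haar_unit])
    show "(\<Sum>p\<in>S. \<bar>F t p * haar n t\<bar>) \<le> K * L * B"
      if "t \<in> space unit_lebesgue" "finite S" "S \<subseteq> {1..} \<times> {1..}" for t S
    proof -
      have "(\<Sum>p\<in>S. \<bar>F t p * haar n t\<bar>) = (\<Sum>p\<in>S. \<bar>F t p\<bar>) * \<bar>haar n t\<bar>"
        by (simp add: abs_mult sum_distrib_right)
      also have "\<dots> \<le> K * L * B"
        using that KL B by (intro mult_mono bd) auto
      finally show ?thesis .
    qed
  qed auto
  moreover have "(\<lambda>p. LINT t|unit_lebesgue. F t p * haar n t) =
      (\<lambda>(i, l). a i * b l * (LINT t|unit_lebesgue. N t i l * haar n t))"
  proof
    fix p :: "nat \<times> nat"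
    obtain i l where p: "p = (i, l)" by (cases p)
    have "(LINT t|unit_lebesgue. F t p * haar n t) =
        (LINT t|unit_lebesgue. a i * b l * (N t i l * haar n t))"
      by (simp add: F_def p mult_ac)
    then show "(LINT t|unit_lebesgue. F t p * haar n t) =
        (case p of (i, l) \<Rightarrow> a i * b l * (LINT t|unit_lebesgue. N t i l * haar n t))"
      by (simp add: p)
  qed
  ultimately show "((\<lambda>(i, l). a i * b l * (LINT t|unit_lebesgue. N t i l * haar n t)) has_sum
      haar_transform (\<lambda>t. bil a (N t) b) n) ({1..} \<times> {1..})"
    by (simp add: haar_transform_def bil_F infsum_cmult_left')
qed

section \<open>Haar transforms of the forms given by Omega and Theta\<close>

lemma measurable_Omega:
  assumes "1 \<le> i" "1 \<le> l"
  shows "(\<lambda>t. Omega t i l) \<in> borel_measurable unit_lebesgue"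
  unfolding Omega_eq[OF assms] by measurable

lemma measurable_Theta: "(\<lambda>t. Theta t i l) \<in> borel_measurable unit_lebesgue"
  unfolding Theta_def by measurable

lemma abs_Theta_le: "\<bar>Theta t i l\<bar> \<le> \<bar>haar i t\<bar> * \<bar>haar l t\<bar>"
  by (simp add: Theta_def power2_eq_square abs_mult)

lemma bil_Omega:
  assumes "haar_abs_bounded a K" "haar_abs_bounded b L"
  shows "t \<in> {0..1} \<Longrightarrow> bil_converges a (Omega t) b"
    and "t \<in> {0..1} \<Longrightarrow> \<bar>bil a (Omega t) b\<bar> \<le> K * L"
    and "(\<lambda>t. bil a (Omega t) b) \<in> borel_measurable unit_lebesgue"
    and "1 \<le> n \<Longrightarrow> ((\<lambda>(i, l). a i * b l * (LINT t|unit_lebesgue. Omega t i l * haar n t)) has_sum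
      haar_transform (\<lambda>t. bil a (Omega t) b) n) ({1..} \<times> {1..})"
  by - ((rule bil_dominated_by_haar[where N = Omega, OF assms]; (rule abs_Omega_le measurable_Omega)?; assumption?)+)

lemma bil_Theta:
  assumes "haar_abs_bounded a K" "haar_abs_bounded b L"
  shows "t \<in> {0..1} \<Longrightarrow> bil_converges a (Theta t) b"
    and "t \<in> {0..1} \<Longrightarrow> \<bar>bil a (Theta t) b\<bar> \<le> K * L"
    and "(\<lambda>t. bil a (Theta t) b) \<in> borel_measurable unit_lebesgue"
    and "1 \<le> n \<Longrightarrow> ((\<lambda>(i, l). a i * b l * (LINT t|unit_lebesgue. Theta t i l * haar n t)) has_sum
      haar_transform (\<lambda>t. bil a (Theta t) b) n) ({1..} \<times> {1..})"
  by - ((rule bil_dominated_by_haar[where N = Theta, OF assms]; (rule abs_Theta_le measurable_Theta)?; assumption?)+)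

text \<open>In the double series of integrals only the column \<open>l = n\<close> survives, so
  \<open>b n\<close> factors out of a single sum over \<open>i\<close>.\<close>

lemma haar_transform_Omega:
  assumes "haar_abs_bounded a K" "haar_abs_bounded b L" "1 \<le> n"
  shows "haar_transform (\<lambda>t. bil a (Omega t) b) n = hadamard (app_inf (transp_inf Omega_tilde) a) b n"
proof -
  let ?g = "\<lambda>(i, l). a i * b l * (LINT t|unit_lebesgue. Omega t i l * haar n t)"
  have "(?g has_sum haar_transform (\<lambda>t. bil a (Omega t) b) n) ({1..} \<times> {1..})"
    by (rule bil_Omega(4)[OF assms])
  also have "?this \<longleftrightarrow> (?g has_sum haar_transform (\<lambda>t. bil a (Omega t) b) n) ((\<lambda>i. (i, n)) ` {1..})"
    using assms(3) by (intro has_sum_cong_neutral) (auto simp: integral_Omega_haar)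
  also have "\<dots> \<longleftrightarrow> ((\<lambda>i. ?g (i, n)) has_sum haar_transform (\<lambda>t. bil a (Omega t) b) n) {1..}"
    by (subst has_sum_reindex) (auto simp: inj_on_def o_def)
  also have "\<dots> \<longleftrightarrow> ((\<lambda>i. transp_inf Omega_tilde n i * a i * b n) has_sum
      haar_transform (\<lambda>t. bil a (Omega t) b) n) {1..}"
    using assms(3) by (intro has_sum_cong) (simp add: integral_Omega_haar transp_inf_def)
  finally have "(\<Sum>\<^sub>\<infinity>i\<in>{1..}. transp_inf Omega_tilde n i * a i * b n) =
      haar_transform (\<lambda>t. bil a (Omega t) b) n"
    by (rule infsumI)
  then show ?thesis by (simp add: hadamard_def app_inf_def infsum_cmult_left')
qed

text \<open>Only diagonal pairs survive, with Gamma as the integrals. The form with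
  \<open>has_sum\<close> also provides the convergence of the matrix product.\<close>

lemma haar_transform_Theta:
  assumes "haar_abs_bounded a K" "haar_abs_bounded b L" "1 \<le> n"
  shows "((\<lambda>i. transp_inf Gamma_mat n i * hadamard a b i) has_sum
    haar_transform (\<lambda>t. bil a (Theta t) b) n) {1..}"
proof -
  let ?g = "\<lambda>(i, l). a i * b l * (LINT t|unit_lebesgue. Theta t i l * haar n t)"
  have "(?g has_sum haar_transform (\<lambda>t. bil a (Theta t) b) n) ({1..} \<times> {1..})"
    by (rule bil_Theta(4)[OF assms])
  also have "?this \<longleftrightarrow> (?g has_sum haar_transform (\<lambda>t. bil a (Theta t) b) n) ((\<lambda>i. (i, i)) ` {1..})"
  proof (rule has_sum_cong_neutral)
    fix p :: "nat \<times> nat" assume "p \<in> {1..} \<times> {1..} - (\<lambda>i. (i, i)) ` {1..}"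
    then obtain i l where "p = (i, l)" "i \<noteq> l" by fastforce
    then show "?g p = 0" by (simp add: Theta_def)
  qed auto
  also have "\<dots> \<longleftrightarrow> ((\<lambda>i. ?g (i, i)) has_sum haar_transform (\<lambda>t. bil a (Theta t) b) n) {1..}"
    by (subst has_sum_reindex) (auto simp: inj_on_def o_def)
  also have "\<dots> \<longleftrightarrow> ((\<lambda>i. transp_inf Gamma_mat n i * hadamard a b i) has_sum
      haar_transform (\<lambda>t. bil a (Theta t) b) n) {1..}"
    using assms(3)
    by (intro has_sum_cong)
       (simp add: Theta_def integral_haar_power2_haar transp_inf_def hadamard_def)
  finally show ?thesis .
qed

text \<open>\<open>Omega_tilde\<close> is strictly upper triangular, so each entry of the product is
  a finite sum.\<close>

lemma app_inf_converges_transp_Omega_tilde: "app_inf_converges (transp_inf Omega_tilde) a"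
  unfolding app_inf_converges_def
proof (intro allI impI)
  fix n :: nat assume n: "1 \<le> n"
  have "Omega_tilde i n = 0" if i: "1 \<le> i" "n \<le> i" for i
    using n
  proof (cases rule: haar_index_cases)
    case scaling
    then show ?thesis using Omega_tilde_1[OF i(1)] by simp
  next
    case (wavelet j k)
    then show ?thesis using Omega_tilde_Suc[OF i(1) wavelet(1)] i by simp
  qed
  then have "{i \<in> {1..}. transp_inf Omega_tilde n i * a i \<noteq> 0} \<subseteq> {..n}"
    by (force simp: transp_inf_def)
  then show "(\<lambda>i. transp_inf Omega_tilde n i * a i) summable_on {1..}"
    by (intro finite_nonzero_values_imp_summable_on) (rule finite_subset, auto)
qed

section \<open>The product formula away from the right end point\<close>

lemma AE_unit_lebesgue_neq_1: "AE t in unit_lebesgue. t \<noteq> 1"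
  by (rule AE_I[of _ _ "{1}"]) (auto simp: emeasure_restrict_space sets_restrict_space)

text \<open>The product of two absolutely convergent series is their double series, which splits
  entry by entry according to the product rule; the three parts converge separately.\<close>

lemma haar_mult_expansion:
  assumes a: "haar_abs_bounded a K" and b: "haar_abs_bounded b L" and t: "t \<in> {0..1}"
  shows "(\<Sum>\<^sub>\<infinity>i\<in>{1..}. a i * haar i t) * (\<Sum>\<^sub>\<infinity>i\<in>{1..}. b i * haar i t) =
    bil a (Omega t) b + bil a (transp_inf (Omega t)) b + bil a (Theta t) b"
proof -
  have conv: "bil_converges a (Omega t) b" "bil_converges a (transp_inf (Omega t)) b"
    "bil_converges a (Theta t) b"
    using bil_Omega(1)[OF a b t] bil_Omega(1)[OF b a t] bil_Theta(1)[OF a b t]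
    by (auto simp: bil_converges_transp_inf)
  let ?g = "\<lambda>N (i, l). a i * N i l * b l"
  have "((\<lambda>p. ?g (Omega t) p + ?g (transp_inf (Omega t)) p + ?g (Theta t) p) has_sum
      (bil a (Omega t) b + bil a (transp_inf (Omega t)) b + bil a (Theta t) b)) ({1..} \<times> {1..})"
    unfolding bil_def by (intro has_sum_add has_sum_infsum conv[unfolded bil_converges_def])
  also have "?this \<longleftrightarrow> ((\<lambda>(i, l). a i * haar i t * (b l * haar l t)) has_sum
      (bil a (Omega t) b + bil a (transp_inf (Omega t)) b + bil a (Theta t) b)) ({1..} \<times> {1..})"
  proof (rule has_sum_cong)
    fix p :: "nat \<times> nat" assume "p \<in> {1..} \<times> {1..}"
    then obtain i l where p: "p = (i, l)" "i \<in> {1..}" "l \<in> {1..}" by blast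
    then have "haar i t * haar l t = Omega t i l + transp_inf (Omega t) i l + Theta t i l"
      by (intro haar_mult_eq_Omega_Theta) auto
    moreover have "a i * haar i t * (b l * haar l t) = a i * (haar i t * haar l t) * b l"
      by (simp add: mult_ac)
    ultimately show "?g (Omega t) p + ?g (transp_inf (Omega t)) p + ?g (Theta t) p
        = (case p of (i, l) \<Rightarrow> a i * haar i t * (b l * haar l t))"
      by (simp add: p(1) algebra_simps)
  qed
  finally have hs: "((\<lambda>(i, l). a i * haar i t * (b l * haar l t)) has_sum
      (bil a (Omega t) b + bil a (transp_inf (Omega t)) b + bil a (Theta t) b)) ({1..} \<times> {1..})" .
  then have "(\<lambda>(i, l). a i * haar i t * (b l * haar l t)) summable_on {1..} \<times> {1..}"
    by (auto simp: summable_on_def)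
  from infsum_product_pairs[OF this] infsumI[OF hs] show ?thesis by simp
qed

lemma haar_coeff_abs_bounded:
  assumes "c \<in> ell2"
  obtains K where "haar_abs_bounded (app_inf (transp_inf haar_P) c) K"
proof -
  note eq = app_inf_transp_haar_P(2)[OF assms]
  have "\<bar>app_inf (transp_inf haar_P) c 1\<bar> \<le> ell2_norm c"
    using haar_coeff_1_le[OF assms] by (simp add: eq del: One_nat_def)
  moreover have "\<bar>app_inf (transp_inf haar_P) c (2 ^ j + k + 1)\<bar> \<le> ell2_norm c / 2 ^ j" if "k < 2 ^ j" for j k
    using haar_coeff_Suc_le[OF assms that] by (subst eq) auto
  ultimately show thesis by (rule that[OF haar_abs_boundedI])
qed

text \<open>Both factors are replaced by their Haar expansions. At 1 all wavelets, and with them the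
  right side, vanish, whereas the left side need not, since \<open>haar_w 1 1\<close> equals
  1.\<close>

lemma haar_W_eq_Omega_Theta:
  assumes c: "c \<in> ell2" and d: "d \<in> ell2" and t: "t \<in> {0..1}" "t \<noteq> 1"
  defines "a \<equiv> app_inf (transp_inf haar_P) c" and "b \<equiv> app_inf (transp_inf haar_P) d"
  shows "haar_W c d t = bil a (Omega t) b + bil a (transp_inf (Omega t)) b + bil a (Theta t) b"
proof -
  have expand: "(\<Sum>\<^sub>\<infinity>i\<in>{1..}. app_inf (transp_inf haar_P) x i * haar i t) = haar_prim x t"
    if x: "x \<in> ell2" for x
  proof -
    obtain M where M: "haar_abs_bounded (app_inf (transp_inf haar_P) x) M"
      using haar_coeff_abs_bounded[OF x] .
    have eq: "app_inf (transp_inf haar_P) x i * haar i t = haar_transform (haar_prim x) i * haar i t"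
      if "i \<in> {1..}" for i
      using app_inf_transp_haar_P(2)[OF x] that by simp
    have "(\<lambda>i. haar_transform (haar_prim x) i * haar i t) summable_on {1..}"
      using haar_expansion_summable[OF M t(1)] by (subst (asm) summable_on_cong[OF eq])
    moreover have "t \<in> {0..<1}" using t by auto
    ultimately show ?thesis
      using haar_expansion_prim[OF x] by (subst infsum_cong[OF eq])
  qed
  obtain K where K: "haar_abs_bounded a K" unfolding a_def using haar_coeff_abs_bounded[OF c] .
  obtain L where L: "haar_abs_bounded b L" unfolding b_def using haar_coeff_abs_bounded[OF d] .
  show ?thesis
    using haar_mult_expansion[OF K L t(1)] expand[OF c] expand[OF d] haar_W_bil(2)[OF c d t(1)]
    by (simp add: a_def b_def)
qed

theorem theorem4p1:
  shows
    "(\<forall>c\<in>ell2. \<forall>d\<in>ell2. \<forall>t\<in>{0..1}.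
        bil_converges c (\<lambda>i l. haar_w i t * haar_w l t) d \<and>
        (\<lambda>i. c i * haar_w i t) summable_on {1..} \<and>
        (\<lambda>i. d i * haar_w i t) summable_on {1..} \<and>
        haar_W c d t =
          (\<Sum>\<^sub>\<infinity>i\<in>{1..}. c i * haar_w i t) * (\<Sum>\<^sub>\<infinity>i\<in>{1..}. d i * haar_w i t)) \<and>
     bilinear_ell2_L2 haar_W \<and>
     (\<exists>C>0. \<forall>c\<in>ell2. \<forall>d\<in>ell2.
        L2_01_norm (haar_W c d) \<le> C * ell2_norm c * ell2_norm d) \<and>
     (\<forall>c\<in>ell2. \<forall>d\<in>ell2.
        app_inf_converges (transp_inf haar_P) c \<and>
        app_inf_converges (transp_inf haar_P) d \<and>
        (let a = app_inf (transp_inf haar_P) c;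
             b = app_inf (transp_inf haar_P) d;
             F_Omega  = (\<lambda>t. bil a (Omega t) b);
             F_OmegaT = (\<lambda>t. bil a (transp_inf (Omega t)) b);
             F_Theta  = (\<lambda>t. bil a (Theta t) b)
         in
           (AE t in lebesgue_on {0..1}.
              bil_converges a (Omega t) b \<and>
              bil_converges a (transp_inf (Omega t)) b \<and>
              bil_converges a (Theta t) b) \<and>
           F_Omega \<in> L2_01 \<and> F_OmegaT \<in> L2_01 \<and> F_Theta \<in> L2_01 \<and>
           (AE t in lebesgue_on {0..1}.
              haar_W c d t = F_Omega t + F_OmegaT t + F_Theta t) \<and>
           (\<forall>i\<ge>1. haar_transform (haar_W c d) i =
              haar_transform F_Omega i + haar_transform F_OmegaT i + haar_transform F_Theta i) \<and>
           app_inf_converges (transp_inf Omega_tilde) a \<and>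
           app_inf_converges (transp_inf Omega_tilde) b \<and>
           app_inf_converges (transp_inf Gamma_mat) (hadamard a b) \<and>
           (\<forall>i\<ge>1. haar_transform F_Omega i =
              hadamard (app_inf (transp_inf Omega_tilde) a) b i) \<and>
           (\<forall>i\<ge>1. haar_transform F_OmegaT i =
              hadamard (app_inf (transp_inf Omega_tilde) b) a i) \<and>
           (\<forall>i\<ge>1. haar_transform F_Theta i =
              app_inf (transp_inf Gamma_mat) (hadamard a b) i)))"
proof (intro conjI ballI)
  fix c d and t :: real assume cd: "c \<in> ell2" "d \<in> ell2" and t: "t \<in> {0..1}"
  show "bil_converges c (\<lambda>i l. haar_w i t * haar_w l t) d"
    by (rule haar_W_bil(1)[OF cd t])
  show "(\<lambda>i. c i * haar_w i t) summable_on {1..}" "(\<lambda>i. d i * haar_w i t) summable_on {1..}"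
    by - (rule haar_prim_summable[OF cd(1) t], rule haar_prim_summable[OF cd(2) t])
  show "haar_W c d t = (\<Sum>\<^sub>\<infinity>i\<in>{1..}. c i * haar_w i t) * (\<Sum>\<^sub>\<infinity>i\<in>{1..}. d i * haar_w i t)"
    using haar_W_bil(2)[OF cd t] by (simp add: haar_prim_def)
next
  show "bilinear_ell2_L2 haar_W" by (rule bilinear_haar_W)
next
  show "\<exists>C>0. \<forall>c\<in>ell2. \<forall>d\<in>ell2. L2_01_norm (haar_W c d) \<le> C * ell2_norm c * ell2_norm d"
    \<comment> \<open>The constant 1 comes from the pointwise bound on an interval of measure
      1.\<close>
    using bounded_in_L2_01(2)[OF measurable_haar_W abs_haar_W_le] by (intro exI[of _ 1]) auto
next
  fix c d assume c: "c \<in> ell2" and d: "d \<in> ell2"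
  show "app_inf_converges (transp_inf haar_P) c" "app_inf_converges (transp_inf haar_P) d"
    using c d by (auto intro: app_inf_transp_haar_P(1))
  define a where "a = app_inf (transp_inf haar_P) c"
  define b where "b = app_inf (transp_inf haar_P) d"
  obtain K where a: "haar_abs_bounded a K" unfolding a_def using haar_coeff_abs_bounded[OF c] .
  obtain L where b: "haar_abs_bounded b L" unfolding b_def using haar_coeff_abs_bounded[OF d] .
  \<comment> \<open>The version with exchanged arguments handles the transposed form.\<close>
  note Omega = bil_Omega[OF a b] and Omega' = bil_Omega[OF b a] and Theta = bil_Theta[OF a b]
  have AE_eq: "AE t in lebesgue_on {0..1}. haar_W c d t =
      bil a (Omega t) b + bil a (transp_inf (Omega t)) b + bil a (Theta t) b"
    using AE_unit_lebesgue_neq_1 by (rule AE_mp, intro AE_I2)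
      (simp add: a_def b_def haar_W_eq_Omega_Theta[OF c d])
  have AE_conv: "AE t in lebesgue_on {0..1}. bil_converges a (Omega t) b \<and>
      bil_converges a (transp_inf (Omega t)) b \<and> bil_converges a (Theta t) b"
    using Omega(1) Omega'(1) Theta(1) by (intro AE_I2) (auto simp: bil_converges_transp_inf)
  have L2: "(\<lambda>t. bil a (Omega t) b) \<in> L2_01" "(\<lambda>t. bil a (transp_inf (Omega t)) b) \<in> L2_01"
    "(\<lambda>t. bil a (Theta t) b) \<in> L2_01"
    unfolding bil_transp_inf
    using bounded_in_L2_01(1)[OF Omega(3) Omega(2)] bounded_in_L2_01(1)[OF Omega'(3) Omega'(2)]
      bounded_in_L2_01(1)[OF Theta(3) Theta(2)] by auto
  have sum: "haar_transform (haar_W c d) i = haar_transform (\<lambda>t. bil a (Omega t) b) i +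
      haar_transform (\<lambda>t. bil a (transp_inf (Omega t)) b) i + haar_transform (\<lambda>t. bil a (Theta t) b) i"
    if i: "1 \<le> i" for i
  proof -
    have [measurable]: "haar_W c d \<in> borel_measurable unit_lebesgue"
      "(\<lambda>t. bil a (Omega t) b) \<in> borel_measurable unit_lebesgue"
      "(\<lambda>t. bil b (Omega t) a) \<in> borel_measurable unit_lebesgue"
      "(\<lambda>t. bil a (Theta t) b) \<in> borel_measurable unit_lebesgue"
      using measurable_haar_W[OF c d] Omega(3) Omega'(3) Theta(3) by auto
    \<comment> \<open>The exceptional null set does not affect the integral; the three forms are
      bounded and measurable, so it may then be split.\<close>
    have "haar_transform (haar_W c d) i = (LINT t|unit_lebesgue. bil a (Omega t) b * haar i t
        + bil b (Omega t) a * haar i t + bil a (Theta t) b * haar i t)"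
      unfolding haar_transform_def
      by (rule integral_cong_AE)
         (use AE_eq in \<open>auto simp: bil_transp_inf distrib_right\<close>)
    also have "\<dots> = (LINT t|unit_lebesgue. bil a (Omega t) b * haar i t)
        + (LINT t|unit_lebesgue. bil b (Omega t) a * haar i t)
        + (LINT t|unit_lebesgue. bil a (Theta t) b * haar i t)"
      using integrable_mult_haar[OF Omega(3) Omega(2) i] integrable_mult_haar[OF Omega'(3) Omega'(2) i]
        integrable_mult_haar[OF Theta(3) Theta(2) i] by simp
    finally show ?thesis by (simp add: haar_transform_def bil_transp_inf)
  qed
  have Gamma: "app_inf_converges (transp_inf Gamma_mat) (hadamard a b)"
    using haar_transform_Theta[OF a b] by (auto simp: app_inf_converges_def summable_on_def)
  have transform_Theta: "haar_transform (\<lambda>t. bil a (Theta t) b) i =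
      app_inf (transp_inf Gamma_mat) (hadamard a b) i" if "1 \<le> i" for i
    using infsumI[OF haar_transform_Theta[OF a b that]] by (simp add: app_inf_def)
  show "let a = app_inf (transp_inf haar_P) c;
             b = app_inf (transp_inf haar_P) d;
             F_Omega  = (\<lambda>t. bil a (Omega t) b);
             F_OmegaT = (\<lambda>t. bil a (transp_inf (Omega t)) b);
             F_Theta  = (\<lambda>t. bil a (Theta t) b)
         in
           (AE t in lebesgue_on {0..1}.
              bil_converges a (Omega t) b \<and>
              bil_converges a (transp_inf (Omega t)) b \<and>
              bil_converges a (Theta t) b) \<and>
           F_Omega \<in> L2_01 \<and> F_OmegaT \<in> L2_01 \<and> F_Theta \<in> L2_01 \<and>
           (AE t in lebesgue_on {0..1}.
              haar_W c d t = F_Omega t + F_OmegaT t + F_Theta t) \<and>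
           (\<forall>i\<ge>1. haar_transform (haar_W c d) i =
              haar_transform F_Omega i + haar_transform F_OmegaT i + haar_transform F_Theta i) \<and>
           app_inf_converges (transp_inf Omega_tilde) a \<and>
           app_inf_converges (transp_inf Omega_tilde) b \<and>
           app_inf_converges (transp_inf Gamma_mat) (hadamard a b) \<and>
           (\<forall>i\<ge>1. haar_transform F_Omega i =
              hadamard (app_inf (transp_inf Omega_tilde) a) b i) \<and>
           (\<forall>i\<ge>1. haar_transform F_OmegaT i =
              hadamard (app_inf (transp_inf Omega_tilde) b) a i) \<and>
           (\<forall>i\<ge>1. haar_transform F_Theta i =
              app_inf (transp_inf Gamma_mat) (hadamard a b) i)"
    unfolding Let_def a_def[symmetric] b_def[symmetric]
    using AE_conv L2 AE_eq sum Gamma transform_Theta haar_transform_Omega[OF a b]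
      haar_transform_Omega[OF b a] app_inf_converges_transp_Omega_tilde
    by (simp add: bil_transp_inf)
qed

end
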